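(* Let $q=q(n)$ satisfy $nq(n)\gg\log n$. Then for any sequence $(G_n)_{n\in\mathbb{N}}$ of $n$-vertex graphs which is weakly $q$-pseudorandom, we have $\lim_{n\to\infty}p_{1,LP}(\mathbb{Z}\times G_n)=4-2\sqrt{3}$.
   Context: A sequence $(G_n)$ of $n$-vertex graphs is weakly $q$-pseudorandom if $\max\{|e(G_n[U])-q|U|^2/2|:\ U\subseteq V(G_n)\}=o(qn^2)$. For a graph $H$, a random graph model on $H$ is a probability measure $\mu$ on subsets of $E(H)$; $\mathbf{H}_\mu$ denotes the resulting random spanning subgraph. $\mu$ is $1$-independent if for all sets $A,B\subseteq E(H)$ whose edges span disjoint vertex sets, $E(\mathbf{H}_\mu)\cap A$ and $E(\mathbf{H}_\mu)\cap B$ are independent. $\mathcal{M}_{1,p}(H)$ is the set of $1$-independent measures on $H$ in which each edge is present with probability exactly $p$. $p_{1,LP}(H)=\inf\{p\in[0,1]:\ \forall\mu\in\mathcal{M}_{1,p}(H),\ \forall\ell\in\mathbb{N},\ \mathbb{P}[\mathbf{H}_\mu\text{ contains a path of length }\ell]>0\}$. $\mathbb{Z}$ is the two-way infinite path on the integers, and $\times$ is the Cartesian product of graphs (vertices $(v_1,v_2)$, with $(u_1,u_2)\sim(v_1,v_2)$ iff either $u_1=v_1$ and $u_2v_2$ is an edge of the second factor, or $u_1v_1$ is an edge of the first factor and $u_2=v_2$). *)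

theory Defs
  imports "HOL-Probability.Probability" "HOL-Library.Landau_Symbols"
begin

text \<open>Graphs are given by their edge set: a set of 2-element vertex sets.
  A random graph model on a graph with edge set E is a probability measure on
  the subsets of E, with the product sigma-algebra generated by the events
  "edge e is present".\<close>

definition edge_event :: "'v set set \<Rightarrow> 'v set \<Rightarrow> 'v set set set" where
  "edge_event E e = {S \<in> Pow E. e \<in> S}"

definition random_graph_model :: "'v set set \<Rightarrow> 'v set set measure \<Rightarrow> bool" where
  "random_graph_model E \<mu> \<longleftrightarrow>
     prob_space \<mu> \<and> space \<mu> = Pow E \<and> sets \<mu> = sigma_sets (Pow E) (edge_event E ` E)"

definition one_independent :: "'v set set \<Rightarrow> 'v set set measure \<Rightarrow> bool" where
  "one_independent E \<mu> \<longleftrightarrow>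
     (\<forall>A B. A \<subseteq> E \<longrightarrow> B \<subseteq> E \<longrightarrow> \<Union>A \<inter> \<Union>B = {} \<longrightarrow>
        prob_space.indep_set \<mu> (sigma_sets (Pow E) (edge_event E ` A))
                               (sigma_sets (Pow E) (edge_event E ` B)))"

definition M1p :: "'v set set \<Rightarrow> real \<Rightarrow> 'v set set measure \<Rightarrow> bool" where
  "M1p E p \<mu> \<longleftrightarrow> random_graph_model E \<mu> \<and> one_independent E \<mu> \<and>
     (\<forall>e\<in>E. measure \<mu> (edge_event E e) = p)"

definition has_path :: "'v set set \<Rightarrow> nat \<Rightarrow> bool" where
  "has_path S l \<longleftrightarrow> (\<exists>vs. length vs = Suc l \<and> distinct vs \<and>
       (\<forall>i<l. {vs ! i, vs ! Suc i} \<in> S))"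

definition p1LP :: "'v set set \<Rightarrow> real" where
  "p1LP E = Inf {p \<in> {0..1}. \<forall>\<mu>. M1p E p \<mu> \<longrightarrow>
       (\<forall>l. measure \<mu> {S \<in> space \<mu>. has_path S l} > 0)}"

definition Z_times_edges :: "(nat \<Rightarrow> nat \<Rightarrow> bool) \<Rightarrow> nat \<Rightarrow> (int \<times> nat) set set" where
  "Z_times_edges G n =
     {{(i, u), (i, v)} | i u v. u < n \<and> v < n \<and> G u v} \<union>
     {{(i, u), (i + 1, u)} | i u. u < n}"

definition e_ind :: "(nat \<Rightarrow> nat \<Rightarrow> bool) \<Rightarrow> nat set \<Rightarrow> nat" where
  "e_ind G U = card {{u, v} | u v. u \<in> U \<and> v \<in> U \<and> G u v}"

definition weakly_pseudorandom :: "(nat \<Rightarrow> real) \<Rightarrow> (nat \<Rightarrow> nat \<Rightarrow> nat \<Rightarrow> bool) \<Rightarrow> bool" where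
  "weakly_pseudorandom q G \<longleftrightarrow>
     (\<lambda>n. Max ((\<lambda>U. \<bar>real (e_ind (G n) U) - q n * real (card U) ^ 2 / 2\<bar>) ` Pow {0..<n}))
       \<in> o(\<lambda>n. q n * real n ^ 2)"

end

theory Submission
  imports Defs
begin

text \<open>
  Write \<open>p0 = 4 - 2 * sqrt 3\<close>, so \<open>sqrt p0 = sqrt 3 - 1\<close>.

  Lower bound. Colour the sites independently, blue with probability \<open>sqrt p0\<close> in the layers \<open>3 k + 1\<close>
  and \<open>sqrt p0 / 2\<close> in the layers \<open>3 k + 2\<close>, and let the colours of the endpoints decide which edges
  are open. Every edge is then open with probability at least \<open>p0\<close>, yet no open path joins
  layer \<open>3 k\<close> to layer \<open>3 k + 3\<close>. Independent thinning of the edges gives every smaller density.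

  Upper bound. Let \<open>p > p0\<close>. In each layer some component contains more than half of the vertices.
  If the majority components of two consecutive layers are not linked, label every big component by
  whether it is reached from the first of them. With the vertices in small components as a third
  class, either layer splits the vertex set into three parts, and both together split it into nine
  pieces. By Chebyshev's inequality each layer has the expected number of edges on each part of the
  other one. Edges join equal labels, so the sizes \<open>f, g, h\<close> of the pieces of a part satisfy
  \<open>p0 * (f + g + h)^2 \<le> f^2 + g^2\<close>, and therefore a linear inequality given by a chord of the
  circle. Four such inequalities show that the two pieces with contradicting labels contain a
  proportion \<open>1 - p0\<close> of the vertices. No rung is open there, which contradicts the density \<open>p\<close>
  of the rungs. So consecutive layers are linked with
  high probability, and these events are one-dependent, hence hold jointly along any finite stretch.
\<close>

section \<open>Edge counts in quasirandom graphs\<close>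

text \<open>Pairs are ordered, so an edge inside \<open>A \<inter> B\<close> counts twice. This
  makes the count additive in each argument, with expected size \<open>q * card A * card B\<close>
  even when \<open>A\<close> and \<open>B\<close> overlap.\<close>

definition pairs :: "('a \<Rightarrow> 'a \<Rightarrow> bool) \<Rightarrow> 'a set \<Rightarrow> 'a set \<Rightarrow> ('a \<times> 'a) set" where
  "pairs G A B = {(a, b) \<in> A \<times> B. G a b}"

lemma finite_pairs [simp]: "finite A \<Longrightarrow> finite B \<Longrightarrow> finite (pairs G A B)"
  unfolding pairs_def by (rule finite_subset[of _ "A \<times> B"]) auto

lemma card_pairs_Un_left:
  assumes "finite A" "finite A'" "finite B" "A \<inter> A' = {}"
  shows "card (pairs G (A \<union> A') B) = card (pairs G A B) + card (pairs G A' B)"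
proof -
  have "pairs G (A \<union> A') B = pairs G A B \<union> pairs G A' B" by (auto simp: pairs_def)
  moreover have "pairs G A B \<inter> pairs G A' B = {}" using assms by (auto simp: pairs_def)
  ultimately show ?thesis using assms by (simp add: card_Un_disjoint)
qed

lemma card_pairs_commute:
  assumes "\<And>u v. G u v \<Longrightarrow> G v u"
  shows "card (pairs G A B) = card (pairs G B A)"
  by (rule bij_betw_same_card[where f = prod.swap])
     (auto simp: bij_betw_def pairs_def inj_on_def image_iff intro: assms)

lemma card_pairs_Un_right:
  assumes "finite A" "finite B" "finite B'" "B \<inter> B' = {}"
  shows "card (pairs G A (B \<union> B')) = card (pairs G A B) + card (pairs G A B')"
proof -
  have "pairs G A (B \<union> B') = pairs G A B \<union> pairs G A B'" by (auto simp: pairs_def)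
  moreover have "pairs G A B \<inter> pairs G A B' = {}" using assms by (auto simp: pairs_def)
  ultimately show ?thesis using assms by (simp add: card_Un_disjoint)
qed

lemma card_pairs_self:
  fixes U :: "nat set"
  assumes fin: "finite U" and G: "\<And>u v. G u v \<Longrightarrow> u \<noteq> v \<and> G v u"
  shows "card (pairs G U U) = 2 * e_ind G U"
proof -
  \<comment> \<open>Every edge is oriented upwards. Forgetting the orientation is injective on
    \<open>P\<close>, and \<open>P\<close> with its mirror image makes up all ordered pairs.\<close>
  define P where "P = {(u, v) \<in> U \<times> U. u < v \<and> G u v}"
  have finP: "finite P"
    unfolding P_def by (rule finite_subset[of _ "U \<times> U"]) (use fin in auto)
  have "{{u, v} |u v. u \<in> U \<and> v \<in> U \<and> G u v} = (\<lambda>(u, v). {u, v}) ` P"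
  proof (intro equalityI subsetI)
    fix e assume "e \<in> {{u, v} |u v. u \<in> U \<and> v \<in> U \<and> G u v}"
    then obtain u v where e: "e = {u, v}" "u \<in> U" "v \<in> U" "G u v" by auto
    then have "u < v \<or> v < u" using G[of u v] by auto
    then show "e \<in> (\<lambda>(u, v). {u, v}) ` P"
    proof
      assume "u < v"
      then show ?thesis using e by (auto simp: P_def intro!: image_eqI[of _ _ "(u, v)"])
    next
      assume "v < u"
      then show ?thesis using e G[of u v]
        by (auto simp: P_def intro!: image_eqI[of _ _ "(v, u)"])
    qed
  qed (auto simp: P_def)
  moreover have "inj_on (\<lambda>(u, v). {u, v}) P"
    by (auto simp: inj_on_def P_def doubleton_eq_iff)
  ultimately have e: "e_ind G U = card P"
    unfolding e_ind_def by (simp add: card_image)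
  have "pairs G U U = P \<union> prod.swap ` P"
  proof (intro equalityI subsetI)
    fix x assume "x \<in> pairs G U U"
    then obtain u v where x: "x = (u, v)" "u \<in> U" "v \<in> U" "G u v" by (auto simp: pairs_def)
    then have "u < v \<or> v < u" using G[of u v] by auto
    then show "x \<in> P \<union> prod.swap ` P"
      using x G[of u v] by (auto simp: P_def image_iff)
  qed (use G in \<open>auto simp: P_def pairs_def\<close>)
  moreover have "P \<inter> prod.swap ` P = {}" by (auto simp: P_def)
  ultimately have "card (pairs G U U) = card P + card (prod.swap ` P)"
    using finP by (simp add: card_Un_disjoint)
  also have "card (prod.swap ` P) = card P" by (rule card_image) simp
  finally show ?thesis using e by simp
qed

locale finite_graph =
  fixes G :: "nat \<Rightarrow> nat \<Rightarrow> bool" and n :: nat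
  assumes graph: "\<And>u v. G u v \<Longrightarrow> u < n \<and> v < n \<and> u \<noteq> v \<and> G v u"

text \<open>Weak pseudorandomness at a single \<open>n\<close> with an explicit relative error. All
  finite estimates take place here; limits enter only in the last section.\<close>

locale quasirandom = finite_graph +
  fixes q \<delta> :: real
  assumes n_pos: "0 < n" and q_pos: "0 < q" and \<delta>_pos: "0 < \<delta>"
    and e_ind_approx: "\<And>U. U \<subseteq> {..<n} \<Longrightarrow>
      \<bar>real (e_ind G U) - q * real (card U) ^ 2 / 2\<bar> \<le> \<delta> * (q * real n ^ 2)"
begin

definition err :: real where "err = \<delta> * (q * real n ^ 2)"

lemma err_pos: "0 < err"
  unfolding err_def using n_pos q_pos \<delta>_pos by simp

lemma pairs_self_approx:
  assumes "U \<subseteq> {..<n}"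
  shows "\<bar>real (card (pairs G U U)) - q * real (card U) ^ 2\<bar> \<le> 2 * err"
proof -
  have "finite U" using assms finite_subset by blast
  then have "real (card (pairs G U U)) = 2 * real (e_ind G U)"
    using card_pairs_self[of U G] graph by simp
  then show ?thesis using e_ind_approx[OF assms] unfolding err_def[symmetric] by linarith
qed

text \<open>Polarisation: the pairs inside \<open>A \<union> B\<close> are those inside
  \<open>A\<close>, those inside \<open>B\<close> and twice the crossing ones. Three errors of
  \<open>2 * err\<close> halve to \<open>3 * err\<close>.\<close>

lemma pairs_disjoint_approx:
  assumes "A \<subseteq> {..<n}" "B \<subseteq> {..<n}" "A \<inter> B = {}"
  shows "\<bar>real (card (pairs G A B)) - q * real (card A) * real (card B)\<bar> \<le> 3 * err"
proof -
  have fin: "finite A" "finite B" using assms finite_subset by blast+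
  have c: "card (A \<union> B) = card A + card B" using fin assms by (simp add: card_Un_disjoint)
  have "card (pairs G (A \<union> B) (A \<union> B)) =
      card (pairs G A A) + card (pairs G B B) + 2 * card (pairs G A B)"
    using fin assms card_pairs_commute[of G A B] graph
    by (simp add: card_pairs_Un_left card_pairs_Un_right)
  then have eq: "real (card (pairs G (A \<union> B) (A \<union> B))) = real (card (pairs G A A))
      + real (card (pairs G B B)) + 2 * real (card (pairs G A B))"
    by (metis of_nat_add of_nat_mult of_nat_numeral)
  have "q * real (card (A \<union> B)) ^ 2 = q * real (card A) ^ 2 + q * real (card B) ^ 2
      + 2 * (q * real (card A) * real (card B))"
    unfolding c by (simp add: power2_eq_square algebra_simps)
  moreover have "A \<union> B \<subseteq> {..<n}" using assms by auto
  ultimately show ?thesis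
    using pairs_self_approx[of "A \<union> B"] pairs_self_approx[OF assms(1)] pairs_self_approx[OF assms(2)] eq
    by linarith
qed

text \<open>Cutting both sets along \<open>A \<inter> B\<close> leaves one diagonal count and three
  disjoint ones, whence \<open>2 + 3 + 3 + 3 = 11\<close>.\<close>

lemma pairs_approx:
  assumes "A \<subseteq> {..<n}" "B \<subseteq> {..<n}"
  shows "\<bar>real (card (pairs G A B)) - q * real (card A) * real (card B)\<bar> \<le> 11 * err"
proof -
  define I A' B' where "I = A \<inter> B" and "A' = A - B" and "B' = B - A"
  have fin: "finite A" "finite B" using assms finite_subset by blast+
  then have fin': "finite I" "finite A'" "finite B'" by (auto simp: I_def A'_def B'_def)
  have sub: "I \<subseteq> {..<n}" "A' \<subseteq> {..<n}" "B' \<subseteq> {..<n}" using assms by (auto simp: I_def A'_def B'_def)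
  have dj: "I \<inter> A' = {}" "I \<inter> B' = {}" "A' \<inter> B' = {}" by (auto simp: I_def A'_def B'_def)
  have AB: "A = I \<union> A'" "B = I \<union> B'" by (auto simp: I_def A'_def B'_def)
  have c: "card A = card I + card A'" "card B = card I + card B'"
    using AB fin' dj card_Un_disjoint by metis+
  have "card (pairs G A B) = card (pairs G I I) + card (pairs G I B')
      + card (pairs G A' I) + card (pairs G A' B')"
    unfolding AB using fin' dj by (simp add: card_pairs_Un_left card_pairs_Un_right)
  then have eq: "real (card (pairs G A B)) = real (card (pairs G I I)) + real (card (pairs G I B'))
      + real (card (pairs G A' I)) + real (card (pairs G A' B'))" by simp
  have qeq: "q * real (card A) * real (card B) = q * real (card I) ^ 2 + q * real (card I) * real (card B')
      + q * real (card A') * real (card I) + q * real (card A') * real (card B')"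
    unfolding c by (simp add: power2_eq_square algebra_simps)
  have "A' \<inter> I = {}" using dj by auto
  show ?thesis
    using pairs_self_approx[OF sub(1)] pairs_disjoint_approx[OF sub(1,3) dj(2)]
      pairs_disjoint_approx[OF sub(2,1) \<open>A' \<inter> I = {}\<close>] pairs_disjoint_approx[OF sub(2,3) dj(3)]
    unfolding eq qeq by linarith
qed

end

text \<open>Greedy bin packing: a new set goes into the last bin unless that bin already exceeds \<open>s\<close>.\<close>

lemma bin_packing:
  fixes F :: "'a set set" and s :: real
  assumes "finite F" "\<And>C. C \<in> F \<Longrightarrow> finite C" "\<And>C. C \<in> F \<Longrightarrow> real (card C) \<le> s"
    and "disjoint F" and s: "0 < s"
  shows "\<exists>(g :: 'a set \<Rightarrow> nat) k. (\<forall>C\<in>F. g C \<le> k) \<and>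
           (\<forall>j\<le>k. real (card (\<Union>{C \<in> F. g C = j})) \<le> 2 * s) \<and>
           real k * s + real (card (\<Union>{C \<in> F. g C = k})) \<le> real (card (\<Union>F))"
  using assms(1-4)
proof (induction F rule: finite_induct)
  case empty
  show ?case using s by (intro exI[of _ "\<lambda>_. 0"] exI[of _ 0]) auto
next
  case (insert C F)
  have dis: "disjoint F" using insert.prems(3) by (simp add: pairwise_insert)
  obtain g :: "'a set \<Rightarrow> nat" and k where g: "\<forall>C\<in>F. g C \<le> k"
    and bins: "\<And>j. j \<le> k \<Longrightarrow> real (card (\<Union>{C \<in> F. g C = j})) \<le> 2 * s"
    and k: "real k * s + real (card (\<Union>{C \<in> F. g C = k})) \<le> real (card (\<Union>F))"
    using insert.IH dis insert.prems by auto
  have CF: "C \<inter> \<Union>F = {}"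
    using insert.prems(3) insert.hyps(2) by (auto simp: pairwise_insert disjnt_def)
  have fin: "finite C" "finite (\<Union>F)" using insert.prems(1) insert.hyps(1) by auto
  have cU: "card (\<Union>(insert C F)) = card C + card (\<Union>F)"
    using fin CF by (simp add: card_Un_disjoint)
  show ?case
  proof (cases "real (card (\<Union>{C \<in> F. g C = k})) \<le> s")
    case True
    define h where "h = g(C := k)"
    have hk: "\<Union>{D \<in> insert C F. h D = k} = C \<union> \<Union>{D \<in> F. g D = k}"
      using insert.hyps(2) by (auto simp: h_def)
    have hj: "\<Union>{D \<in> insert C F. h D = j} = \<Union>{D \<in> F. g D = j}" if "j \<noteq> k" for j
      using insert.hyps(2) that by (auto simp: h_def)
    have ck: "card (\<Union>{D \<in> insert C F. h D = k}) = card C + card (\<Union>{D \<in> F. g D = k})"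
    proof -
      have "finite (\<Union>{D \<in> F. g D = k})" by (rule finite_subset[OF _ fin(2)]) auto
      then show ?thesis unfolding hk using CF fin by (intro card_Un_disjoint) auto
    qed
    have "real (card (\<Union>{D \<in> insert C F. h D = j})) \<le> 2 * s" if "j \<le> k" for j
    proof (cases "j = k")
      case True
      then show ?thesis using ck insert.prems(2)[of C] \<open>real (card (\<Union>{C \<in> F. g C = k})) \<le> s\<close> by simp
    qed (use hj bins that in simp)
    then show ?thesis using g ck cU k
      by (intro exI[of _ h] exI[of _ k]) (auto simp: h_def)
  next
    case False
    define h where "h = g(C := Suc k)"
    have hk: "\<Union>{D \<in> insert C F. h D = Suc k} = C"
      using insert.hyps(2) g by (auto simp: h_def)
    have hj: "\<Union>{D \<in> insert C F. h D = j} = \<Union>{D \<in> F. g D = j}" if "j \<le> k" for j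
      using insert.hyps(2) that by (auto simp: h_def)
    have "real (card (\<Union>{D \<in> insert C F. h D = j})) \<le> 2 * s" if "j \<le> Suc k" for j
    proof (cases "j = Suc k")
      case True
      then show ?thesis using hk insert.prems(2)[of C] s by simp
    qed (use hj bins that in simp)
    \<comment> \<open>Bin \<open>k\<close> is closed only after exceeding \<open>s\<close>, which
      pays for the increment of \<open>k\<close>.\<close>
    moreover have "real (Suc k) * s + real (card C) \<le> real (card (\<Union>(insert C F)))"
      using cU k False by (simp add: algebra_simps)
    ultimately show ?thesis using g hk
      by (intro exI[of _ h] exI[of _ "Suc k"]) (auto simp: h_def le_SucI)
  qed
qed

section \<open>Components of typical subgraphs\<close>

definition comps :: "(nat \<Rightarrow> nat \<Rightarrow> bool) \<Rightarrow> nat \<Rightarrow> nat set set" where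
  "comps H n = (\<lambda>u. {v. v < n \<and> H\<^sup>*\<^sup>* u v}) ` {..<n}"

lemma finite_comps [simp]: "finite (comps H n)"
  by (simp add: comps_def)

lemma comps_subset: "C \<in> comps H n \<Longrightarrow> C \<subseteq> {..<n}"
  by (auto simp: comps_def)

lemma finite_comp: "C \<in> comps H n \<Longrightarrow> finite C"
  by (rule finite_subset[OF comps_subset]) auto

lemma Union_comps: "\<Union>(comps H n) = {..<n}"
  by (auto simp: comps_def)

lemma comps_closed:
  assumes "C \<in> comps H n" "a \<in> C" "H a b" "b < n"
  shows "b \<in> C"
  using assms rtranclp.rtrancl_into_rtrancl[of H _ a b] unfolding comps_def by blast

lemma comps_connected:
  assumes "C \<in> comps H n" "a \<in> C" "b \<in> C" and sym: "\<And>u v. H u v \<Longrightarrow> H v u"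
  shows "H\<^sup>*\<^sup>* a b"
proof -
  obtain u where u: "H\<^sup>*\<^sup>* u a" "H\<^sup>*\<^sup>* u b" using assms(1-3) by (auto simp: comps_def)
  have "symp (H\<^sup>*\<^sup>*)" using sym by (intro symp_rtranclp) (auto simp: symp_def)
  then have "H\<^sup>*\<^sup>* a u" using u(1) by (rule sympD)
  then show ?thesis using u(2) by (rule rtranclp_trans)
qed

lemma comps_eqI:
  assumes "C \<in> comps H n" "D \<in> comps H n" "a \<in> C" "a \<in> D" and sym: "\<And>u v. H u v \<Longrightarrow> H v u"
  shows "C = D"
proof -
  have sub: "C \<subseteq> D" if CD: "C \<in> comps H n" "D \<in> comps H n" "a \<in> C" "a \<in> D" for C D
  proof
    fix x assume x: "x \<in> C"
    have ax: "H\<^sup>*\<^sup>* a x" by (rule comps_connected[OF CD(1,3) x sym])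
    obtain w where D: "D = {v. v < n \<and> H\<^sup>*\<^sup>* w v}" using CD(2) unfolding comps_def by blast
    have "H\<^sup>*\<^sup>* w a" using CD(4) D by simp
    moreover have "x < n" using x comps_subset[OF CD(1)] by auto
    ultimately show "x \<in> D" using ax unfolding D by (simp add: rtranclp_trans[of H w a x])
  qed
  show ?thesis using sub assms by (intro equalityI) auto
qed

lemma disjoint_comps:
  assumes "\<And>u v. H u v \<Longrightarrow> H v u"
  shows "disjoint (comps H n)"
proof (rule pairwiseI)
  fix C D assume "C \<in> comps H n" "D \<in> comps H n" "C \<noteq> D"
  then show "disjnt C D"
    unfolding disjnt_iff using comps_eqI[where H = H, OF _ _ _ _ assms] by blast
qed

definition bigs :: "(nat \<Rightarrow> nat \<Rightarrow> bool) \<Rightarrow> nat \<Rightarrow> nat \<Rightarrow> nat set set" where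
  "bigs H n b = {C \<in> comps H n. n \<le> b * card C}"

lemma finite_bigs [simp]: "finite (bigs H n b)"
  by (simp add: bigs_def)

lemma bigs_comps: "C \<in> bigs H n b \<Longrightarrow> C \<in> comps H n"
  by (simp add: bigs_def)

lemma Union_bigs_subset: "\<Union>(bigs H n b) \<subseteq> {..<n}"
  using comps_subset by (auto simp: bigs_def)

lemma sum_card_comps:
  assumes "\<And>u v. H u v \<Longrightarrow> H v u" "F \<subseteq> comps H n"
  shows "(\<Sum>C\<in>F. card C) \<le> n"
proof -
  have "disjoint F"
    using disjoint_comps[where H = H and n = n, OF assms(1)] assms(2) by (rule pairwise_subset)
  then have "(\<Sum>C\<in>F. card C) = card (\<Union>F)"
    using assms(2) finite_comp
    by (intro card_Union_disjoint[symmetric]) (auto simp: pairwise_def)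
  also have "\<dots> \<le> card {..<n}"
    using assms(2) comps_subset[where H = H and n = n] by (intro card_mono) blast+
  finally show ?thesis by simp
qed

text \<open>Big components are disjoint and each takes up at least a fraction \<open>1 / b\<close>
  of the \<open>n\<close> vertices.\<close>

lemma card_bigs:
  assumes "\<And>u v. H u v \<Longrightarrow> H v u" "0 < n"
  shows "card (bigs H n b) \<le> b"
proof -
  have "n * card (bigs H n b) \<le> (\<Sum>C\<in>bigs H n b. b * card C)"
    using sum_mono[of "bigs H n b" "\<lambda>_. n" "\<lambda>C. b * card C"]
    by (simp add: bigs_def mult.commute)
  also have "\<dots> \<le> b * n"
    using sum_card_comps[where H = H and n = n and F = "bigs H n b", OF assms(1)] by (simp add: bigs_def flip: sum_distrib_left)
  finally show ?thesis using assms(2) by simp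
qed

text \<open>Whether two layers are linked is decided by the edge counts of one layer on these sets, which
  are few and determined by the other layer. Only big components are labelled individually, so that
  the number of sets stays bounded.\<close>

definition probes :: "(nat \<Rightarrow> nat \<Rightarrow> bool) \<Rightarrow> nat \<Rightarrow> nat \<Rightarrow> nat set set" where
  "probes H n b = Union ` Pow (bigs H n b) \<union> {{..<n} - \<Union>(bigs H n b), {..<n}}"

lemma finite_probes [simp]: "finite (probes H n b)"
  by (simp add: probes_def)

lemma probes_subset: "X \<in> probes H n b \<Longrightarrow> X \<subseteq> {..<n}"
  using Union_bigs_subset[of H n b] unfolding probes_def by blast

text \<open>The bound does not grow with \<open>n\<close>, so a union bound over the probes survives
  the limit.\<close>

lemma card_probes:
  assumes "\<And>u v. H u v \<Longrightarrow> H v u" "0 < n"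
  shows "card (probes H n b) \<le> 2 ^ b + 2"
proof -
  have "card (Union ` Pow (bigs H n b)) \<le> 2 ^ card (bigs H n b)"
    using card_image_le[of "Pow (bigs H n b)" Union] by (simp add: card_Pow)
  also have "\<dots> \<le> 2 ^ b" using card_bigs[where H = H, OF assms] by simp
  finally have 1: "card (Union ` Pow (bigs H n b)) \<le> 2 ^ b" .
  have "card {{..<n} - \<Union>(bigs H n b), {..<n}} \<le> 2"
    by (rule order.trans[OF card_insert_le_m1]) auto
  then show ?thesis
    using 1 card_Un_le[of "Union ` Pow (bigs H n b)" "{{..<n} - \<Union>(bigs H n b), {..<n}}"]
    unfolding probes_def by linarith
qed

section \<open>Typical edge counts and components\<close>

context quasirandom
begin

definition subgraph :: "(nat \<Rightarrow> nat \<Rightarrow> bool) \<Rightarrow> bool" where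
  "subgraph H \<longleftrightarrow> (\<forall>u v. H u v \<longrightarrow> G u v \<and> H v u)"

lemma subgraph_sym: "subgraph H \<Longrightarrow> H u v \<Longrightarrow> H v u"
  by (auto simp: subgraph_def)

lemma subgraph_less: "subgraph H \<Longrightarrow> H u v \<Longrightarrow> u < n \<and> v < n"
  using graph by (auto simp: subgraph_def)

lemma subgraph_comps_closed:
  assumes "subgraph H" "C \<in> comps H n" "H a b"
  shows "a \<in> C \<longleftrightarrow> b \<in> C"
  using assms comps_closed[OF assms(2)] subgraph_sym[OF assms(1)] subgraph_less[OF assms(1)] by blast

lemma card_pairs_le:
  assumes "A \<subseteq> {..<n}" "B \<subseteq> {..<n}"
  shows "real (card (pairs G A B)) \<le> q * real (card A) * real (card B) + 11 * err"
  using pairs_approx[OF assms] by linarith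

text \<open>There may be about \<open>n\<close> small components, and estimating them one by one
  would cost \<open>11 * err\<close> each. Packed into at most \<open>b + 1\<close> bins of at most
  \<open>2 * n / b\<close> vertices they cost that error only \<open>b + 1\<close> times, and the
  main terms add up to at most \<open>q * (2 * n / b) * n\<close>.\<close>

lemma card_small_pairs:
  assumes H: "subgraph H" and b: "0 < b"
  shows "real (card (\<Union>C \<in> comps H n - bigs H n b. pairs G C C))
           \<le> 2 / real b * (q * real n ^ 2) + 11 * (real b + 1) * err"
proof -
  define F s where "F = comps H n - bigs H n b" and "s = real n / real b"
  note sym = subgraph_sym[OF H]
  have s: "0 < s" using n_pos b by (simp add: s_def)
  have disF: "disjoint F"
    using disjoint_comps[where H = H and n = n, OF sym] by (rule pairwise_subset) (auto simp: F_def)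
  have "real (card C) \<le> s" if "C \<in> F" for C
  proof -
    have "b * card C \<le> n" using that by (auto simp: F_def bigs_def)
    then have "real b * real (card C) \<le> real n" by (metis of_nat_le_iff of_nat_mult)
    then show ?thesis using b by (simp add: s_def field_simps)
  qed
  moreover have "finite F" "\<And>C. C \<in> F \<Longrightarrow> finite C" using finite_comp by (auto simp: F_def)
  ultimately obtain g :: "nat set \<Rightarrow> nat" and k where g: "\<And>C. C \<in> F \<Longrightarrow> g C \<le> k"
    and bins: "\<And>j. j \<le> k \<Longrightarrow> real (card (\<Union>{C \<in> F. g C = j})) \<le> 2 * s"
    and k: "real k * s + real (card (\<Union>{C \<in> F. g C = k})) \<le> real (card (\<Union>F))"
    using bin_packing[of F s] disF s by blast
  define Z where "Z j = \<Union>{C \<in> F. g C = j}" for j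
  have FV: "\<Union>F \<subseteq> {..<n}" using comps_subset by (auto simp: F_def)
  have ZV: "Z j \<subseteq> {..<n}" for j using FV by (auto simp: Z_def)
  have finZ: "finite (Z j)" for j using ZV finite_subset by blast
  have cF: "card (\<Union>F) \<le> n" using card_mono[OF _ FV] by simp
  have "real k * s \<le> real n" using k cF by linarith
  then have kb: "k \<le> b" using b n_pos by (simp add: s_def field_simps)
  have "disjoint_family_on Z {..k}"
    unfolding disjoint_family_on_def
  proof (intro ballI impI)
    fix i j :: nat assume "i \<noteq> j"
    then have "C \<inter> D = {}" if "C \<in> F" "g C = i" "D \<in> F" "g D = j" for C D
    proof -
      have "C \<noteq> D" using that \<open>i \<noteq> j\<close> by auto
      then show ?thesis using disF that by (simp add: pairwise_def disjnt_def)
    qed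
    then show "Z i \<inter> Z j = {}" unfolding Z_def by blast
  qed
  then have "(\<Sum>j\<le>k. card (Z j)) = card (\<Union>j\<le>k. Z j)"
    using finZ by (intro card_UN_disjoint[symmetric]) (auto simp: disjoint_family_on_def)
  also have "\<dots> \<le> n" using card_mono[of "{..<n}" "\<Union>j\<le>k. Z j"] ZV by auto
  finally have sumZ: "(\<Sum>j\<le>k. real (card (Z j))) \<le> real n"
    by (simp only: of_nat_le_iff flip: of_nat_sum)
  have "(\<Union>C\<in>F. pairs G C C) \<subseteq> (\<Union>j\<le>k. pairs G (Z j) (Z j))"
  proof
    fix x assume "x \<in> (\<Union>C\<in>F. pairs G C C)"
    then obtain C where C: "C \<in> F" "x \<in> pairs G C C" by blast
    then have "C \<subseteq> Z (g C)" by (auto simp: Z_def)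
    then have "x \<in> pairs G (Z (g C)) (Z (g C))" using C(2) by (auto simp: pairs_def)
    then show "x \<in> (\<Union>j\<le>k. pairs G (Z j) (Z j))" using g[OF C(1)] by blast
  qed
  then have "card (\<Union>C\<in>F. pairs G C C) \<le> card (\<Union>j\<le>k. pairs G (Z j) (Z j))"
    using finZ by (intro card_mono) auto
  also have "\<dots> \<le> (\<Sum>j\<le>k. card (pairs G (Z j) (Z j)))" by (rule card_UN_le) auto
  finally have "real (card (\<Union>C\<in>F. pairs G C C)) \<le> real (\<Sum>j\<le>k. card (pairs G (Z j) (Z j)))"
    by (simp only: of_nat_le_iff)
  also have "\<dots> = (\<Sum>j\<le>k. real (card (pairs G (Z j) (Z j))))" by (rule of_nat_sum)
  also have "\<dots> \<le> (\<Sum>j\<le>k. q * (2 * s) * real (card (Z j)) + 11 * err)"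
  proof (rule sum_mono)
    fix j assume j: "j \<in> {..k}"
    have "q * real (card (Z j)) * real (card (Z j)) \<le> q * (2 * s) * real (card (Z j))"
      using bins[of j] j q_pos by (intro mult_right_mono mult_left_mono) (auto simp: Z_def)
    then show "real (card (pairs G (Z j) (Z j))) \<le> q * (2 * s) * real (card (Z j)) + 11 * err"
      using pairs_approx[OF ZV ZV, of j j] by linarith
  qed
  also have "\<dots> = q * (2 * s) * (\<Sum>j\<le>k. real (card (Z j))) + 11 * (real k + 1) * err"
    by (simp add: sum.distrib sum_distrib_left algebra_simps)
  also have "\<dots> \<le> q * (2 * s) * real n + 11 * (real b + 1) * err"
    using sumZ q_pos s kb err_pos by (intro add_mono mult_left_mono mult_right_mono) auto
  also have "q * (2 * s) * real n = 2 / real b * (q * real n ^ 2)"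
    by (simp add: s_def power2_eq_square)
  finally show ?thesis by (simp add: F_def)
qed

text \<open>One-sided: a lower bound on the open pairs is played off against an upper bound from the
  edges of \<open>G\<close> that stay inside components.\<close>

definition typical :: "real \<Rightarrow> (nat \<Rightarrow> nat \<Rightarrow> bool) \<Rightarrow> nat set \<Rightarrow> nat set \<Rightarrow> bool" where
  "typical p H A B \<longleftrightarrow> p * real (card (pairs G A B)) - err \<le> real (card (pairs H A B))"

text \<open>The total error relative to \<open>q * n ^ 2\<close>: \<open>2 / b\<close> comes from
  small components, the rest from multiples of \<open>err\<close>. The coefficient dominates both
  \<open>11 * b + 45\<close> from \<open>typical_split\<close> and \<open>22 * b + 23\<close> from
  \<open>exists_majority_component\<close>.\<close>

definition slack :: "nat \<Rightarrow> real" where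
  "slack b = 2 / real b + (22 * real b + 45) * \<delta>"

lemma typical_approx:
  assumes "typical p H A B" "A \<subseteq> {..<n}" "B \<subseteq> {..<n}" "0 \<le> p" "p \<le> 1"
  shows "p * (q * real (card A) * real (card B)) - 12 * err \<le> real (card (pairs H A B))"
proof -
  have "p * (q * real (card A) * real (card B) - 11 * err) \<le> p * real (card (pairs G A B))"
    using pairs_approx[OF assms(2,3)] assms(4) by (intro mult_left_mono) linarith+
  moreover have "p * (11 * err) \<le> 1 * (11 * err)"
    using assms(5) err_pos by (intro mult_right_mono) auto
  ultimately show ?thesis
    using assms(1) unfolding typical_def by (simp add: algebra_simps)
qed

lemma divide_q:
  assumes "q * x \<le> q * y + (2 / real b * (q * real n ^ 2) + K * err)" "K \<le> 22 * real b + 45"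
  shows "x \<le> y + slack b * real n ^ 2"
proof -
  have "K * err \<le> (22 * real b + 45) * err" using assms(2) err_pos by (intro mult_right_mono) auto
  then have "q * x \<le> q * (y + slack b * real n ^ 2)"
    using assms(1) by (simp add: slack_def err_def algebra_simps)
  then show ?thesis using q_pos by simp
qed

text \<open>An open edge stays inside one component of \<open>H\<close>, hence inside
  \<open>Y\<close>, inside \<open>Y'\<close> or inside a small component. Dividing by
  \<open>q\<close> leaves an inequality between set sizes alone.\<close>

lemma typical_split:
  assumes H: "subgraph H" and b: "0 < b" and T: "T \<subseteq> bigs H n b"
    and A: "A \<subseteq> {..<n}" and B: "B \<subseteq> {..<n}" and p: "0 \<le> p" "p \<le> 1" and ty: "typical p H A B"
    and Y: "Y = \<Union>T" "Y' = \<Union>(bigs H n b - T)"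
  shows "p * real (card A) * real (card B)
     \<le> real (card (A \<inter> Y)) * real (card (B \<inter> Y)) + real (card (A \<inter> Y')) * real (card (B \<inter> Y'))
        + slack b * real n ^ 2"
proof -
  define S where "S = (\<Union>C \<in> comps H n - bigs H n b. pairs G C C)"
  have fin: "finite A" "finite B" using A B finite_subset by blast+
  have finS: "finite S" unfolding S_def using finite_comp by auto
  have "pairs H A B \<subseteq> (pairs G (A \<inter> Y) (B \<inter> Y) \<union> pairs G (A \<inter> Y') (B \<inter> Y')) \<union> S"
  proof
    fix x assume "x \<in> pairs H A B"
    then obtain u v where x: "x = (u, v)" "u \<in> A" "v \<in> B" "H u v" by (auto simp: pairs_def)
    obtain C where C: "C \<in> comps H n" "u \<in> C" using x(2) A Union_comps[of H n] by auto
    have "v \<in> C" using subgraph_comps_closed[OF H C(1) x(4)] C by simp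
    moreover have "G u v" using x(4) H by (auto simp: subgraph_def)
    ultimately show "x \<in> (pairs G (A \<inter> Y) (B \<inter> Y) \<union> pairs G (A \<inter> Y') (B \<inter> Y')) \<union> S"
      using x C by (auto simp: pairs_def S_def Y)
  qed
  then have "card (pairs H A B) \<le> card ((pairs G (A \<inter> Y) (B \<inter> Y) \<union> pairs G (A \<inter> Y') (B \<inter> Y')) \<union> S)"
    using fin finS by (intro card_mono) auto
  also have "\<dots> \<le> card (pairs G (A \<inter> Y) (B \<inter> Y)) + card (pairs G (A \<inter> Y') (B \<inter> Y')) + card S"
    by (intro order.trans[OF card_Un_le] add_mono card_Un_le order.refl)
  finally have "real (card (pairs H A B))
      \<le> real (card (pairs G (A \<inter> Y) (B \<inter> Y))) + real (card (pairs G (A \<inter> Y') (B \<inter> Y'))) + real (card S)"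
    by linarith
  moreover have "real (card (pairs G (A \<inter> Y) (B \<inter> Y)))
      \<le> q * real (card (A \<inter> Y)) * real (card (B \<inter> Y)) + 11 * err"
    using A B by (intro card_pairs_le) auto
  moreover have "real (card (pairs G (A \<inter> Y') (B \<inter> Y')))
      \<le> q * real (card (A \<inter> Y')) * real (card (B \<inter> Y')) + 11 * err"
    using A B by (intro card_pairs_le) auto
  moreover have "real (card S) \<le> 2 / real b * (q * real n ^ 2) + 11 * (real b + 1) * err"
    unfolding S_def by (rule card_small_pairs[OF H b])
  ultimately have "p * (q * real (card A) * real (card B)) - 12 * err
     \<le> q * real (card (A \<inter> Y)) * real (card (B \<inter> Y)) + q * real (card (A \<inter> Y')) * real (card (B \<inter> Y'))
        + 22 * err + (2 / real b * (q * real n ^ 2) + 11 * (real b + 1) * err)"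
    using typical_approx[OF ty A B p] by linarith
  then have "q * (p * real (card A) * real (card B))
     \<le> q * (real (card (A \<inter> Y)) * real (card (B \<inter> Y)) + real (card (A \<inter> Y')) * real (card (B \<inter> Y')))
        + (2 / real b * (q * real n ^ 2) + (11 * real b + 45) * err)"
    by (simp add: algebra_simps)
  then show ?thesis by (rule divide_q) simp
qed

text \<open>If all components had at most \<open>n / 2\<close> vertices, they would contain at most
  about half of the pairs of \<open>G\<close>, whereas the open pairs have density about
  \<open>p\<close>, which exceeds \<open>1 / 2\<close> by more than the slack.\<close>

lemma exists_majority_component:
  assumes H: "subgraph H" and b: "0 < b" and p: "0 \<le> p" "p \<le> 1"
    and ty: "typical p H {..<n} {..<n}" and sl: "slack b < p - 1 / 2"
  shows "\<exists>C\<in>comps H n. n < 2 * card C"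
proof (rule ccontr)
  assume "\<not> ?thesis"
  then have small: "2 * card C \<le> n" if "C \<in> comps H n" for C using that by auto
  define S where "S = (\<Union>C \<in> comps H n - bigs H n b. pairs G C C)"
  note sym = subgraph_sym[OF H]
  have finS: "finite S" unfolding S_def using finite_comp by auto
  have "pairs H {..<n} {..<n} \<subseteq> (\<Union>C\<in>bigs H n b. pairs G C C) \<union> S"
  proof
    fix x assume "x \<in> pairs H {..<n} {..<n}"
    then obtain u v where x: "x = (u, v)" "u < n" "H u v" by (auto simp: pairs_def)
    obtain C where C: "C \<in> comps H n" "u \<in> C" using x(2) Union_comps[of H n] by auto
    have "v \<in> C" using subgraph_comps_closed[OF H C(1) x(3)] C by simp
    moreover have "G u v" using x(3) H by (auto simp: subgraph_def)
    ultimately show "x \<in> (\<Union>C\<in>bigs H n b. pairs G C C) \<union> S"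
      using x C by (auto simp: pairs_def S_def)
  qed
  then have "card (pairs H {..<n} {..<n}) \<le> card ((\<Union>C\<in>bigs H n b. pairs G C C) \<union> S)"
    using finS finite_comp[OF bigs_comps] by (intro card_mono finite_UnI finite_UN_I finite_pairs) auto
  also have "\<dots> \<le> (\<Sum>C\<in>bigs H n b. card (pairs G C C)) + card S"
    by (intro order.trans[OF card_Un_le] add_mono card_UN_le order.refl) simp
  finally have le: "real (card (pairs H {..<n} {..<n}))
      \<le> (\<Sum>C\<in>bigs H n b. real (card (pairs G C C))) + real (card S)"
    by (simp only: of_nat_le_iff flip: of_nat_sum of_nat_add)
  have "(\<Sum>C\<in>bigs H n b. real (card (pairs G C C)))
      \<le> (\<Sum>C\<in>bigs H n b. q * (real n / 2) * real (card C) + 11 * err)"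
  proof (rule sum_mono)
    fix C assume "C \<in> bigs H n b"
    then have C: "C \<in> comps H n" by (rule bigs_comps)
    have "q * real (card C) * real (card C) \<le> q * (real n / 2) * real (card C)"
      using small[OF C] q_pos by (intro mult_right_mono mult_left_mono) auto
    then show "real (card (pairs G C C)) \<le> q * (real n / 2) * real (card C) + 11 * err"
      using pairs_approx[OF comps_subset[OF C] comps_subset[OF C]] by linarith
  qed
  also have "\<dots> = q * (real n / 2) * real (\<Sum>C\<in>bigs H n b. card C) + 11 * real (card (bigs H n b)) * err"
    by (simp add: sum.distrib sum_distrib_left)
  also have "\<dots> \<le> q * (real n / 2) * real n + 11 * real b * err"
  proof -
    have "(\<Sum>C\<in>bigs H n b. card C) \<le> n"
      using bigs_comps by (intro sum_card_comps[where H = H, OF sym]) auto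
    moreover have "card (bigs H n b) \<le> b" using sym n_pos by (rule card_bigs)
    ultimately show ?thesis using q_pos err_pos
      by (intro add_mono mult_left_mono mult_right_mono) (simp_all del: of_nat_sum)
  qed
  finally have "p * (q * real n * real n) - 12 * err \<le> q * (real n / 2) * real n + 11 * real b * err
      + (2 / real b * (q * real n ^ 2) + 11 * (real b + 1) * err)"
    using le card_small_pairs[OF H b] typical_approx[OF ty _ _ p] unfolding S_def by simp
  then have "q * (p * real n ^ 2) \<le> q * (real n ^ 2 / 2)
      + (2 / real b * (q * real n ^ 2) + (22 * real b + 23) * err)"
    by (simp add: algebra_simps power2_eq_square)
  then have "p * real n ^ 2 \<le> real n ^ 2 / 2 + slack b * real n ^ 2" by (rule divide_q) simp
  then have "(p - 1 / 2 - slack b) * real n ^ 2 \<le> 0" by (simp add: algebra_simps)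
  then show False using sl n_pos by (simp add: mult_le_0_iff)
qed

end

section \<open>Linking two layers\<close>

abbreviation p0 :: real where "p0 \<equiv> 4 - 2 * sqrt 3"

lemma sqrt3_bounds: "1.7 < sqrt 3" "sqrt 3 < 1.74"
  by (rule real_less_rsqrt real_less_lsqrt; simp add: power2_eq_square)+

text \<open>The chord joins the points \<open>((3 - sqrt 3) / 2, (sqrt 3 - 1) / 2)\<close> and \<open>(sqrt 3 - 1, 0)\<close> of the
  circle of radius \<open>sqrt p0 = sqrt 3 - 1\<close>.\<close>

lemma chord_bound:
  fixes f g h :: real
  assumes "0 \<le> f" "0 \<le> g" "0 \<le> h" "g \<le> f"
    and circle: "p0 * (f + g + h) ^ 2 \<le> f ^ 2 + g ^ 2"
  shows "sqrt 3 * g + (1 + sqrt 3) * h \<le> f"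
proof (rule ccontr)
  define k t :: real where "k = sqrt 3" and "t = 2 - k"
  have k2: "k * k = 3" by (simp add: k_def)
  have k: "1.7 < k" "k < 1.74"
    unfolding k_def by (rule sqrt3_bounds)+
  have t: "0 < t" using k by (simp add: t_def)
  \<comment> \<open>\<open>e\<close> is the amount by which the claim fails. As
    \<open>(k - 1) / (k + 1) = t\<close>, replacing \<open>h\<close> by \<open>e\<close> turns
    \<open>(k - 1) * (f + g + h)\<close> into \<open>f + t * (g + e)\<close>, and
    \<open>(k - 1) ^ 2\<close> is \<open>p0\<close>.\<close>
  define e where "e = k * g + (1 + k) * h - f"
  assume "\<not> ?thesis"
  then have e: "0 < e" by (simp add: e_def k_def)
  have "(k - 1) * (f + g + h) = f + t * (g + e)"
    by (simp add: e_def t_def algebra_simps k2)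
  then have "(k - 1) ^ 2 * (f + g + h) ^ 2 = (f + t * (g + e)) ^ 2"
    by (metis power_mult_distrib)
  moreover have "(k - 1) ^ 2 = 4 - 2 * sqrt 3"
    using k2 by (simp add: power2_eq_square algebra_simps flip: k_def)
  ultimately have "(f + t * (g + e)) ^ 2 \<le> f ^ 2 + g ^ 2" using circle by simp
  then have le: "2 * t * f * (g + e) + t ^ 2 * (g + e) ^ 2 \<le> g ^ 2"
    by (simp add: power2_eq_square algebra_simps)
  \<comment> \<open>This expresses that \<open>circle\<close> is tight at the end
    \<open>f = k * g\<close>, \<open>h = 0\<close> of the chord, where \<open>e = 0\<close>.\<close>
  have tk: "2 * t * k + t ^ 2 = 1"
    by (simp add: t_def power2_eq_square algebra_simps k2)
  \<comment> \<open>There are two lower bounds for \<open>f\<close>: the hypothesis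
    \<open>g \<le> f\<close>, and \<open>k * g - e \<le> f\<close> from \<open>0 \<le> h\<close>.
    They agree at \<open>e = (k - 1) * g\<close>, and each case uses the larger one.\<close>
  show False
  proof (cases "(k - 1) * g \<le> e")
    case True
    then have ge: "k * g \<le> g + e" by (simp add: algebra_simps)
    have "2 * t * (g * (k * g)) \<le> 2 * t * (f * (g + e))"
      using ge assms t k e by (intro mult_left_mono mult_mono) auto
    moreover have "t ^ 2 * ((k * g) * (k * g)) \<le> t ^ 2 * ((g + e) * (g + e))"
      using ge assms k e by (intro mult_left_mono mult_mono) auto
    moreover have "t ^ 2 * ((k * g) * (k * g)) = 3 * t ^ 2 * g ^ 2"
    proof -
      have "(k * g) * (k * g) = 3 * g ^ 2" using k2 by (simp add: power2_eq_square mult.assoc mult.left_commute)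
      then show ?thesis by simp
    qed
    moreover have "2 * t * (g * (k * g)) = (2 * t * k) * g ^ 2" by (simp add: power2_eq_square)
    moreover have "2 * t * (f * (g + e)) + t ^ 2 * ((g + e) * (g + e)) \<le> g ^ 2"
      using le by (simp only: power2_eq_square mult.assoc)
    ultimately have "(2 * t * k) * g ^ 2 + 3 * t ^ 2 * g ^ 2 \<le> g ^ 2" by linarith
    moreover have "(2 * t * k) * g ^ 2 = g ^ 2 - t ^ 2 * g ^ 2"
      using tk by (metis add_diff_cancel_right' left_diff_distrib mult_1)
    ultimately have "t ^ 2 * g ^ 2 \<le> 0" by linarith
    then have "g = 0" using t by (simp add: mult_le_0_iff)
    then have "2 * t * f * e + t ^ 2 * e ^ 2 \<le> 0" using le by simp
    moreover have "0 \<le> 2 * t * f * e" using t e assms by simp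
    moreover have "0 < t ^ 2 * e ^ 2" using t e by simp
    ultimately show False by linarith
  next
    case False
    then have eg: "e < (k - 1) * g" by simp
    have g: "0 < g" using eg e k assms by (cases "g = 0") auto
    have f: "k * g - e \<le> f"
      using assms(3) k by (simp add: e_def)
    have "2 * t * ((k * g - e) * (g + e)) \<le> 2 * t * (f * (g + e))"
      using f t g e by (intro mult_left_mono mult_right_mono) auto
    then have "2 * t * ((k * g - e) * (g + e)) + t ^ 2 * (g + e) ^ 2 \<le> g ^ 2"
      using le by (simp add: algebra_simps)
    moreover have "2 * t * ((k * g - e) * (g + e)) + t ^ 2 * (g + e) ^ 2
        = (2 * t * k + t ^ 2) * g ^ 2 + e * ((2 * t * (k - 1) + 2 * t ^ 2) * g - (2 * t - t ^ 2) * e)"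
      by (simp add: power2_eq_square algebra_simps)
    ultimately have "e * ((2 * t * (k - 1) + 2 * t ^ 2) * g - (2 * t - t ^ 2) * e) \<le> 0"
      unfolding tk by simp
    then have "(2 * t * (k - 1) + 2 * t ^ 2) * g \<le> (2 * t - t ^ 2) * e"
      using e by (simp add: mult_le_0_iff)
    also have "\<dots> \<le> (2 * t - t ^ 2) * ((k - 1) * g)"
      using eg k by (intro mult_left_mono) (auto simp: t_def power2_eq_square algebra_simps k2)
    finally have "t ^ 2 * (k + 1) * g \<le> 0" by (simp add: power2_eq_square algebra_simps)
    then show False using t g k by (simp add: mult_le_0_iff)
  qed
qed

text \<open>A part with fewer than \<open>\<eta> * n\<close> vertices is absorbed by the error term.
  For a larger one the gap between \<open>p\<close> and \<open>p0\<close> swallows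
  \<open>\<omega>\<close>, so \<open>self\<close> gives the exact circle inequality. The comparison
  \<open>total\<close> with the whole layer decides the order \<open>g \<le> f\<close> that the
  chord needs.\<close>

lemma approx_chord_bound:
  fixes f g h y y' n p \<eta> \<omega> :: real
  assumes nonneg: "0 \<le> f" "0 \<le> g" "0 \<le> h" and n: "0 < n" and \<eta>: "0 < \<eta>"
    and p: "p0 < p" and \<omega>: "\<omega> \<le> (p - p0) * \<eta> ^ 2" "\<omega> < (p - 1 / 2) * \<eta>"
    and y: "y' \<le> y" "y + y' \<le> n"
    and self: "p * (f + g + h) * (f + g + h) \<le> f * f + g * g + \<omega> * n ^ 2"
    and total: "p * (f + g + h) * n \<le> f * y + g * y' + \<omega> * n ^ 2"
  shows "sqrt 3 * g + (1 + sqrt 3) * h \<le> f + 5 * \<eta> * n"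
proof (cases "f + g + h < \<eta> * n")
  case True
  have "sqrt 3 * g + (1 + sqrt 3) * h \<le> 5 * (f + g + h)"
    using nonneg sqrt3_bounds mult_right_mono[of "sqrt 3" 5 g] mult_right_mono[of "1 + sqrt 3" 5 h]
    by (simp add: algebra_simps)
  moreover have "5 * (f + g + h) < 5 * \<eta> * n" using True by simp
  ultimately show ?thesis using nonneg by linarith
next
  case False
  define s where "s = f + g + h"
  have s: "\<eta> * n \<le> s" using False by (simp add: s_def)
  have half: "1 / 2 < p" using p sqrt3_bounds by simp
  have "g \<le> f"
  proof (rule ccontr)
    assume "\<not> g \<le> f"
    \<comment> \<open>Chebyshev's sum inequality: if the larger part faced the smaller side, at most
      about half of the pairs could be open, but \<open>p\<close> exceeds
      \<open>1 / 2\<close>.\<close>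
    then have "0 \<le> (g - f) * (y - y')" using y by simp
    then have "2 * (f * y + g * y') \<le> (f + g) * (y + y')" by (simp add: algebra_simps)
    also have "\<dots> \<le> s * n" using nonneg y n unfolding s_def
      by (smt (verit) mult_left_mono mult_right_mono)
    finally have "p * s * n \<le> s * n / 2 + \<omega> * n ^ 2" using total by (simp add: s_def)
    then have "(p - 1 / 2) * s * n \<le> (\<omega> * n) * n" by (simp add: algebra_simps power2_eq_square)
    then have "(p - 1 / 2) * s \<le> \<omega> * n" using n by simp
    moreover have "(p - 1 / 2) * (\<eta> * n) \<le> (p - 1 / 2) * s" using s half by (intro mult_left_mono) auto
    ultimately have "(p - 1 / 2) * \<eta> * n \<le> \<omega> * n" by simp
    then show False using \<omega>(2) n by simp
  qed
  moreover have "p0 * (f + g + h) ^ 2 \<le> f ^ 2 + g ^ 2"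
  proof -
    have "(\<eta> * n) ^ 2 \<le> s ^ 2" using s \<eta> n by (intro power_mono) auto
    then have "(p - p0) * (\<eta> * n) ^ 2 \<le> (p - p0) * s ^ 2" using p by (intro mult_left_mono) auto
    moreover have "\<omega> * n ^ 2 \<le> (p - p0) * \<eta> ^ 2 * n ^ 2" using \<omega>(1) by (intro mult_right_mono) auto
    ultimately have "\<omega> * n ^ 2 \<le> (p - p0) * s ^ 2" by (simp add: power_mult_distrib mult.assoc)
    moreover have "p * s ^ 2 \<le> f ^ 2 + g ^ 2 + \<omega> * n ^ 2"
      using self by (simp add: s_def power2_eq_square mult.assoc)
    ultimately show ?thesis unfolding s_def by (simp add: left_diff_distrib)
  qed
  ultimately have "sqrt 3 * g + (1 + sqrt 3) * h \<le> f" using nonneg by (intro chord_bound) auto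
  then show ?thesis using \<eta> n by (smt (verit) mult_pos_pos)
qed

text \<open>Linear programming duality with all four multipliers equal to 1. The pieces with
  contradicting labels are \<open>b\<close> and \<open>c\<close>; since
  \<open>sqrt 3 / (2 + sqrt 3) = 1 - p0\<close>, they fill the proportion \<open>1 - p0\<close> up
  to the error.\<close>

lemma chord_program:
  fixes a b c d r r' s s' t n e :: real
  assumes "sqrt 3 * a + (1 + sqrt 3) * r \<le> b + e" "sqrt 3 * d + (1 + sqrt 3) * s \<le> b + e"
    and "sqrt 3 * r' + (1 + sqrt 3) * t \<le> r + e" "sqrt 3 * s' + (1 + sqrt 3) * t \<le> s + e"
    and "n = a + b + c + d + r + r' + s + s' + t" and "0 \<le> c" "0 \<le> t"
  shows "sqrt 3 * n \<le> (2 + sqrt 3) * (b + c) + 4 * e"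
proof -
  have "sqrt 3 * n = sqrt 3 * a + sqrt 3 * b + sqrt 3 * c + sqrt 3 * d + sqrt 3 * r + sqrt 3 * r'
      + sqrt 3 * s + sqrt 3 * s' + sqrt 3 * t"
    using assms(5) by (simp add: algebra_simps)
  moreover have "0 \<le> sqrt 3 * t" using assms by simp
  ultimately show ?thesis using assms unfolding distrib_right distrib_left by linarith
qed

context quasirandom
begin

text \<open>The probes come from \<open>H\<close> and the edges are counted in \<open>H'\<close>. If
  the two are independent layers, the probes are fixed sets from the point of view of
  \<open>H'\<close>.\<close>

definition fully_typical :: "real \<Rightarrow> nat \<Rightarrow> (nat \<Rightarrow> nat \<Rightarrow> bool) \<Rightarrow> (nat \<Rightarrow> nat \<Rightarrow> bool) \<Rightarrow> bool" where
  "fully_typical p b H H' \<longleftrightarrow> (\<forall>X\<in>probes H n b. typical p H' X X \<and> typical p H' X {..<n})"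

text \<open>\<open>typical_split\<close> is applied twice: \<open>X\<close> against itself gives the
  circle, and \<open>X\<close> against the whole layer shows that the majority side \<open>Y\<close>
  takes the larger share of \<open>X\<close>.\<close>

lemma probe_chord_bound:
  assumes H: "subgraph H" and b: "0 < b" and T: "T \<subseteq> bigs H n b"
    and Y: "Y = \<Union>T" "Y' = \<Union>(bigs H n b - T)" and maj: "n < 2 * card Y"
    and X: "X \<subseteq> {..<n}" "typical p H X X" "typical p H X {..<n}"
    and p: "p0 < p" "p \<le> 1" and \<eta>: "0 < \<eta>"
    and sl: "slack b \<le> (p - p0) * \<eta> ^ 2" "slack b < (p - 1 / 2) * \<eta>"
  shows "sqrt 3 * real (card (X \<inter> Y'))
      + (1 + sqrt 3) * real (card (X \<inter> ({..<n} - \<Union>(bigs H n b)))) \<le> real (card (X \<inter> Y)) + 5 * \<eta> * real n"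
proof -
  define Z where "Z = {..<n} - \<Union>(bigs H n b)"
  have YV: "Y \<subseteq> {..<n}" "Y' \<subseteq> {..<n}" using Y T Union_bigs_subset[of H n b] by auto
  have "disjoint (bigs H n b)"
    using disjoint_comps[where H = H and n = n, OF subgraph_sym[OF H]]
    by (rule pairwise_subset) (auto dest: bigs_comps)
  then have YY': "Y \<inter> Y' = {}" using T unfolding Y by (fastforce simp: pairwise_def disjnt_def)
  have cover: "Y \<union> Y' \<union> Z = {..<n}" "(Y \<union> Y') \<inter> Z = {}"
    using T Union_bigs_subset[of H n b] unfolding Y Z_def by auto
  have fin: "finite X" "finite Y" "finite Y'" using X(1) YV finite_subset by blast+
  have "X = (X \<inter> Y) \<union> (X \<inter> Y') \<union> (X \<inter> Z)" using X(1) cover by auto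
  then have "card X = card ((X \<inter> Y) \<union> (X \<inter> Y') \<union> (X \<inter> Z))" by simp
  also have "\<dots> = card (X \<inter> Y) + card (X \<inter> Y') + card (X \<inter> Z)"
    using fin YY' cover(2) by (subst card_Un_disjoint; (subst card_Un_disjoint)?; auto)
  finally have cX: "real (card X) = real (card (X \<inter> Y)) + real (card (X \<inter> Y')) + real (card (X \<inter> Z))"
    by simp
  have "card (Y \<union> Y') \<le> card {..<n}" using YV by (intro card_mono) auto
  then have cY: "card Y + card Y' \<le> n" using card_Un_disjoint[OF fin(2,3) YY'] by simp
  have p': "0 \<le> p" using p sqrt3_bounds by simp
  have int: "{..<n} \<inter> Y = Y" "{..<n} \<inter> Y' = Y'" using YV by auto
  show ?thesis
    unfolding Z_def[symmetric]
  proof (rule approx_chord_bound[where y = "real (card Y)" and y' = "real (card Y')" and \<omega> = "slack b"])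
    show "p * (real (card (X \<inter> Y)) + real (card (X \<inter> Y')) + real (card (X \<inter> Z)))
        * (real (card (X \<inter> Y)) + real (card (X \<inter> Y')) + real (card (X \<inter> Z)))
        \<le> real (card (X \<inter> Y)) * real (card (X \<inter> Y)) + real (card (X \<inter> Y')) * real (card (X \<inter> Y'))
          + slack b * real n ^ 2"
      using typical_split[OF H b T X(1) X(1) p' p(2) X(2) Y] unfolding cX .
    show "p * (real (card (X \<inter> Y)) + real (card (X \<inter> Y')) + real (card (X \<inter> Z))) * real n
        \<le> real (card (X \<inter> Y)) * real (card Y) + real (card (X \<inter> Y')) * real (card Y')
          + slack b * real n ^ 2"
      using typical_split[OF H b T X(1) _ p' p(2) X(3) Y] unfolding cX int by simp
  qed (use maj cY p \<eta> sl n_pos in auto)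
qed

text \<open>\<open>U\<close> and \<open>U'\<close> stand for reachability from a fixed vertex; only
  invariance along open edges and rungs is used. If the label did not pass from \<open>C\<close> to
  \<open>D\<close>, the pieces with contradicting labels would be too large to fit beside the rungs
  in \<open>M\<close>.\<close>

lemma two_layers:
  assumes H: "subgraph H" "subgraph H'" and b: "0 < b"
    and ty: "fully_typical p b H H'" "fully_typical p b H' H"
    and p: "p0 < p" "p \<le> 1" and \<eta>: "0 < \<eta>"
    and sl: "slack b \<le> (p - p0) * \<eta> ^ 2" "slack b < (p - 1 / 2) * \<eta>"
    and \<eta>\<delta>: "10 * \<eta> + \<delta> < p - p0"
    and M: "M \<subseteq> {..<n}" "(p - \<delta>) * real n \<le> real (card M)"
    and C: "C \<in> comps H n" "n < 2 * card C" and D: "D \<in> comps H' n" "n < 2 * card D"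
    and U: "\<And>a b. H a b \<Longrightarrow> U a \<longleftrightarrow> U b" "\<And>a b. H' a b \<Longrightarrow> U' a \<longleftrightarrow> U' b" "\<And>u. u \<in> M \<Longrightarrow> U u \<longleftrightarrow> U' u"
    and UC: "\<exists>a\<in>C. U a"
  shows "\<exists>a\<in>D. U' a"
proof (rule ccontr)
  assume UD: "\<not> ?thesis"
  have const: "P u \<longleftrightarrow> P v"
    if "\<And>a b. K a b \<Longrightarrow> P a \<longleftrightarrow> P b" "subgraph K" "E \<in> comps K n" "u \<in> E" "v \<in> E" for P K E u v
  proof -
    have "K\<^sup>*\<^sup>* u v" using comps_connected[OF that(3,4,5)] subgraph_sym[OF that(2)] by blast
    then show ?thesis by (induction rule: rtranclp_induct) (use that(1) in auto)
  qed
  have big: "E \<in> bigs K n b" if "E \<in> comps K n" "n < 2 * card E" "b \<ge> 2" for E K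
    using that order.trans[OF less_imp_le_nat mult_le_mono1[of 2 b "card E"]] by (simp add: bigs_def)
  \<comment> \<open>This makes majority components big. With \<open>b = 1\<close> the slack would be
    at least 2, while \<open>sl\<close> keeps it below 1.\<close>
  have b2: "2 \<le> b"
  proof (rule ccontr)
    assume "\<not> 2 \<le> b"
    then have "b = 1" using b by simp
    then have "2 \<le> slack b" using \<delta>_pos by (simp add: slack_def)
    moreover have "(p - 1 / 2) * \<eta> \<le> (p - 1 / 2) * 1"
      using p sqrt3_bounds \<eta>\<delta> \<delta>_pos by (intro mult_left_mono) auto
    ultimately show False using sl p by simp
  qed
  \<comment> \<open>\<open>T\<close> collects reached components but \<open>T'\<close> unreached
    ones, so that each contains the majority component of its layer, as
    \<open>probe_chord_bound\<close> requires.\<close>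
  define T T' where "T = {E \<in> bigs H n b. \<exists>a\<in>E. U a}" and "T' = {E \<in> bigs H' n b. \<not> (\<exists>a\<in>E. U' a)}"
  define X1 X0 Xs where "X1 = \<Union>T" and "X0 = \<Union>(bigs H n b - T)" and "Xs = {..<n} - \<Union>(bigs H n b)"
  define Y0 Y1 Ys where "Y0 = \<Union>T'" and "Y1 = \<Union>(bigs H' n b - T')" and "Ys = {..<n} - \<Union>(bigs H' n b)"
  have T: "T \<subseteq> bigs H n b" "T' \<subseteq> bigs H' n b" by (auto simp: T_def T'_def)
  have X1U: "U u" if "u \<in> X1" for u
    using that const[of H U, OF U(1) H(1) bigs_comps] unfolding X1_def T_def by blast
  have X0U: "\<not> U u" if "u \<in> X0" for u
    using that unfolding X0_def T_def by blast
  have Y0U: "\<not> U' u" if "u \<in> Y0" for u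
    using that unfolding Y0_def T'_def by blast
  have Y1U: "U' u" if "u \<in> Y1" for u
    using that const[of H' U', OF U(2) H(2) bigs_comps] unfolding Y1_def T'_def by blast
  have V: "X1 \<subseteq> {..<n}" "X0 \<subseteq> {..<n}" "Xs \<subseteq> {..<n}" "Y1 \<subseteq> {..<n}" "Y0 \<subseteq> {..<n}" "Ys \<subseteq> {..<n}"
    using T Union_bigs_subset[of H n b] Union_bigs_subset[of H' n b]
    unfolding X1_def X0_def Xs_def Y1_def Y0_def Ys_def by blast+
  have "C \<subseteq> X1" using big[OF C b2] UC by (auto simp: X1_def T_def)
  then have maj: "n < 2 * card X1" using C(2) card_mono[OF finite_subset[OF V(1)], of C] by simp
  have "D \<subseteq> Y0" using big[OF D b2] UD by (auto simp: Y0_def T'_def)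
  then have maj': "n < 2 * card Y0" using D(2) card_mono[OF finite_subset[OF V(5)], of D] by simp
  have probes: "X1 \<in> probes H n b" "Xs \<in> probes H n b" "Y0 \<in> probes H' n b" "Ys \<in> probes H' n b"
    using T unfolding probes_def X1_def Xs_def Y0_def Ys_def by auto
  define N where "N A B = real (card (A \<inter> B))" for A B :: "nat set"
  have N_commute: "N A B = N B A" for A B by (simp add: N_def Int_commute)
  note pc = probe_chord_bound[OF _ b _ _ _ _ _ _ _ p \<eta> sl, folded N_def]
  have 1: "sqrt 3 * N X1 Y1 + (1 + sqrt 3) * N X1 Ys \<le> N X1 Y0 + 5 * \<eta> * real n"
    unfolding Ys_def by (rule pc[OF H(2) T(2) Y0_def Y1_def maj' V(1)])
      (use ty(1) probes in \<open>auto simp: fully_typical_def\<close>)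
  have 2: "sqrt 3 * N Xs Y1 + (1 + sqrt 3) * N Xs Ys \<le> N Xs Y0 + 5 * \<eta> * real n"
    unfolding Ys_def by (rule pc[OF H(2) T(2) Y0_def Y1_def maj' V(3)])
      (use ty(1) probes in \<open>auto simp: fully_typical_def\<close>)
  have 3: "sqrt 3 * N Y0 X0 + (1 + sqrt 3) * N Y0 Xs \<le> N Y0 X1 + 5 * \<eta> * real n"
    unfolding Xs_def by (rule pc[OF H(1) T(1) X1_def X0_def maj V(5)])
      (use ty(2) probes in \<open>auto simp: fully_typical_def\<close>)
  have 4: "sqrt 3 * N Ys X0 + (1 + sqrt 3) * N Ys Xs \<le> N Ys X1 + 5 * \<eta> * real n"
    unfolding Xs_def by (rule pc[OF H(1) T(1) X1_def X0_def maj V(6)])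
      (use ty(2) probes in \<open>auto simp: fully_typical_def\<close>)
  have split: "real (card A) = N A B1 + N A B0 + N A Bs"
    if "A \<subseteq> {..<n}" "B1 \<union> B0 \<union> Bs = {..<n}" "B1 \<inter> B0 = {}" "(B1 \<union> B0) \<inter> Bs = {}" for A B1 B0 Bs
  proof -
    have "finite A" using that(1) finite_subset by blast
    have "A = (A \<inter> B1) \<union> (A \<inter> B0) \<union> (A \<inter> Bs)" using that by auto
    then have "card A = card ((A \<inter> B1) \<union> (A \<inter> B0) \<union> (A \<inter> Bs))" by simp
    also have "\<dots> = card (A \<inter> B1) + card (A \<inter> B0) + card (A \<inter> Bs)"
      using \<open>finite A\<close> that(3,4) by (subst card_Un_disjoint; (subst card_Un_disjoint)?; auto)
    finally show ?thesis by (simp add: N_def)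
  qed
  have X: "X1 \<union> X0 \<union> Xs = {..<n}" "X1 \<inter> X0 = {}" "(X1 \<union> X0) \<inter> Xs = {}"
    using T V X1U X0U unfolding X1_def X0_def Xs_def by blast+
  have Y: "Y1 \<union> Y0 \<union> Ys = {..<n}" "Y1 \<inter> Y0 = {}" "(Y1 \<union> Y0) \<inter> Ys = {}"
    using T V Y1U Y0U unfolding Y1_def Y0_def Ys_def by blast+
  have "real n = N {..<n} X1 + N {..<n} X0 + N {..<n} Xs"
    using split[OF subset_refl X] by simp
  moreover have "N {..<n} X1 = real (card X1)" "N {..<n} X0 = real (card X0)" "N {..<n} Xs = real (card Xs)"
    using V by (simp_all add: N_def Int_absorb1)
  ultimately have n: "real n = N X1 Y1 + N X1 Y0 + N X0 Y1 + N X0 Y0 + N X1 Ys + N X0 Ys + N Xs Y0 + N Xs Y1 + N Xs Ys"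
    using split[OF V(1) Y] split[OF V(2) Y] split[OF V(3) Y] by linarith
  have "sqrt 3 * real n \<le> (2 + sqrt 3) * (N X1 Y0 + N X0 Y1) + 4 * (5 * \<eta> * real n)"
    by (rule chord_program[OF 1 3[unfolded N_commute[of Y0]] 4[unfolded N_commute[of Ys]] 2 n])
      (simp_all add: N_def)
  \<comment> \<open>The labels contradict each other on these two pieces, so no vertex of
    \<open>M\<close> lies there.\<close>
  moreover have "N X1 Y0 + N X0 Y1 \<le> (1 - p + \<delta>) * real n"
  proof -
    have disj: "M \<inter> ((X1 \<inter> Y0) \<union> (X0 \<inter> Y1)) = {}" "(X1 \<inter> Y0) \<inter> (X0 \<inter> Y1) = {}"
      using U(3) X1U X0U Y0U Y1U by blast+
    have fin: "finite M" "finite (X1 \<inter> Y0)" "finite (X0 \<inter> Y1)"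
      using M(1) V by (auto intro: finite_subset)
    have "card (M \<union> ((X1 \<inter> Y0) \<union> (X0 \<inter> Y1))) \<le> card {..<n}" using M(1) V by (intro card_mono) auto
    then have "card M + (card (X1 \<inter> Y0) + card (X0 \<inter> Y1)) \<le> n"
      using fin disj by (simp add: card_Un_disjoint)
    then have "real (card M) + (N X1 Y0 + N X0 Y1) \<le> real n" unfolding N_def by linarith
    then show ?thesis using M(2) by (simp add: algebra_simps)
  qed
  then have "(2 + sqrt 3) * (N X1 Y0 + N X0 Y1) \<le> (2 + sqrt 3) * ((1 - p + \<delta>) * real n)"
    by (intro mult_left_mono) auto
  ultimately have "sqrt 3 * real n \<le> ((2 + sqrt 3) * (1 - p + \<delta>) + 20 * \<eta>) * real n"
    by (simp add: algebra_simps)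
  then have "sqrt 3 \<le> (2 + sqrt 3) * (1 - p + \<delta>) + 20 * \<eta>" using n_pos by simp
  \<comment> \<open>As \<open>(2 + sqrt 3) * (1 - p0) = sqrt 3\<close>, the last inequality means
    \<open>(2 + sqrt 3) * z \<le> 20 * \<eta>\<close>, against
    \<open>10 * \<eta> < z\<close>.\<close>
  moreover define z where "z = p - p0 - \<delta>"
  have "(2 + sqrt 3) * (1 - p + \<delta>) = sqrt 3 - (2 + sqrt 3) * z"
    by (simp add: z_def algebra_simps)
  moreover have "10 * \<eta> < z" using \<eta>\<delta> by (simp add: z_def)
  moreover from this have "2 * z \<le> (2 + sqrt 3) * z"
    using \<eta> by (intro mult_right_mono) auto
  ultimately show False by linarith
qed

end

section \<open>One-independent models\<close>

locale one_independent_model =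
  fixes E :: "'v set set" and p :: real and \<mu> :: "'v set set measure"
  assumes M1p: "M1p E p \<mu>"
begin

sublocale prob_space \<mu>
  using M1p by (simp add: M1p_def random_graph_model_def)

lemma space_eq [simp]: "space \<mu> = Pow E"
  using M1p by (simp add: M1p_def random_graph_model_def)

lemma sets_eq: "sets \<mu> = sigma_sets (Pow E) (edge_event E ` E)"
  using M1p by (simp add: M1p_def random_graph_model_def)

lemma edge_event_sets: "e \<in> E \<Longrightarrow> edge_event E e \<in> events"
  by (simp add: sets_eq)

lemma prob_edge_event: "e \<in> E \<Longrightarrow> prob (edge_event E e) = p"
  using M1p by (simp add: M1p_def)

lemma p_bounds: "E \<noteq> {} \<Longrightarrow> 0 \<le> p \<and> p \<le> 1"
  using prob_edge_event measure_nonneg prob_le_1 by (metis ex_in_conv)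

text \<open>Splitting on the presence of the newly added edge turns \<open>Q\<close> into two other
  predicates of \<open>S \<inter> A\<close>; this is why the induction varies
  \<open>Q\<close>.\<close>

lemma local_event:
  assumes "finite A" "A \<subseteq> E"
  shows "{S \<in> Pow E. Q (S \<inter> A)} \<in> sigma_sets (Pow E) (edge_event E ` A)"
  using assms
proof (induction A arbitrary: Q rule: finite_induct)
  case empty
  have "{S \<in> Pow E. Q (S \<inter> {})} = (if Q {} then Pow E else {})" by auto
  then show ?case by (auto intro: sigma_sets_top sigma_sets.Empty)
next
  case (insert e A)
  let ?\<Sigma> = "sigma_sets (Pow E) (edge_event E ` insert e A)"
  have "edge_event E ` insert e A \<subseteq> Pow (Pow E)" by (auto simp: edge_event_def)
  then interpret \<Sigma>: sigma_algebra "Pow E" ?\<Sigma> by (rule sigma_algebra_sigma_sets)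
  have "sigma_sets (Pow E) (edge_event E ` A) \<subseteq> ?\<Sigma>" by (rule sigma_sets_mono') auto
  then have A: "{S \<in> Pow E. R (S \<inter> A)} \<in> ?\<Sigma>" for R using insert by blast
  have e: "edge_event E e \<in> ?\<Sigma>" by auto
  have "{S \<in> Pow E. Q (S \<inter> insert e A)} =
      (edge_event E e \<inter> {S \<in> Pow E. Q (insert e (S \<inter> A))}) \<union>
      ((Pow E - edge_event E e) \<inter> {S \<in> Pow E. Q (S \<inter> A)})"
  proof (intro set_eqI)
    fix S
    have "S \<inter> insert e A = (if e \<in> S then insert e (S \<inter> A) else S \<inter> A)" by auto
    then show "S \<in> {S \<in> Pow E. Q (S \<inter> insert e A)} \<longleftrightarrow>
      S \<in> (edge_event E e \<inter> {S \<in> Pow E. Q (insert e (S \<inter> A))}) \<union>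
      ((Pow E - edge_event E e) \<inter> {S \<in> Pow E. Q (S \<inter> A)})"
      by (auto simp: edge_event_def)
  qed
  also have "\<dots> \<in> ?\<Sigma>"
    using A e by (intro \<Sigma>.Un \<Sigma>.Int \<Sigma>.compl_sets) auto
  finally show ?case .
qed

lemma local_event_measurable:
  assumes "finite A" "A \<subseteq> E"
  shows "{S \<in> Pow E. Q (S \<inter> A)} \<in> events"
  using local_event[OF assms, of Q] sigma_sets_mono'[of "edge_event E ` A" "edge_event E ` E" "Pow E"] assms(2)
  unfolding sets_eq by blast

lemma prob_disjoint_events:
  assumes "finite A" "A \<subseteq> E" "finite B" "B \<subseteq> E" "\<Union>A \<inter> \<Union>B = {}"
  shows "prob {S \<in> Pow E. Q (S \<inter> A) \<and> R (S \<inter> B)}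
    = prob {S \<in> Pow E. Q (S \<inter> A)} * prob {S \<in> Pow E. R (S \<inter> B)}"
proof -
  have "indep_set (sigma_sets (Pow E) (edge_event E ` A)) (sigma_sets (Pow E) (edge_event E ` B))"
    using M1p assms by (simp add: M1p_def one_independent_def)
  then have "prob ({S \<in> Pow E. Q (S \<inter> A)} \<inter> {S \<in> Pow E. R (S \<inter> B)})
    = prob {S \<in> Pow E. Q (S \<inter> A)} * prob {S \<in> Pow E. R (S \<inter> B)}"
    using local_event assms by (intro indep_setD) auto
  also have "{S \<in> Pow E. Q (S \<inter> A)} \<inter> {S \<in> Pow E. R (S \<inter> B)} = {S \<in> Pow E. Q (S \<inter> A) \<and> R (S \<inter> B)}"
    by auto
  finally show ?thesis .
qed

text \<open>Conditioning on the configuration on \<open>A\<close>: a bound for every frozen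
  configuration survives averaging, because \<open>B\<close> is independent of \<open>A\<close>. It
  serves for probes that are themselves random.\<close>

lemma prob_conditional_bound:
  assumes A: "finite A" "A \<subseteq> E" and B: "finite B" "B \<subseteq> E" and AB: "\<Union>A \<inter> \<Union>B = {}"
    and bound: "\<And>h. h \<subseteq> A \<Longrightarrow> prob {S \<in> Pow E. Q h (S \<inter> B)} \<le> c"
  shows "prob {S \<in> Pow E. Q (S \<inter> A) (S \<inter> B)} \<le> c"
proof -
  define F where "F h = {S \<in> Pow E. S \<inter> A = h \<and> Q h (S \<inter> B)}" for h
  have F: "F h \<in> events" for h
  proof -
    have "{S \<in> Pow E. S \<inter> A = h} \<inter> {S \<in> Pow E. Q h (S \<inter> B)} \<in> events"
      using local_event_measurable[OF A, of "\<lambda>S. S = h"] local_event_measurable[OF B] by (rule sets.Int)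
    also have "{S \<in> Pow E. S \<inter> A = h} \<inter> {S \<in> Pow E. Q h (S \<inter> B)} = F h" by (auto simp: F_def)
    finally show ?thesis .
  qed
  have "{S \<in> Pow E. Q (S \<inter> A) (S \<inter> B)} = (\<Union>h\<in>Pow A. F h)" by (auto simp: F_def)
  then have "prob {S \<in> Pow E. Q (S \<inter> A) (S \<inter> B)} \<le> (\<Sum>h\<in>Pow A. prob (F h))"
    using A(1) F by (auto intro!: finite_measure_subadditive_finite)
  also have "\<dots> \<le> (\<Sum>h\<in>Pow A. prob {S \<in> Pow E. S \<inter> A = h} * c)"
  proof (rule sum_mono)
    fix h assume "h \<in> Pow A"
    then show "prob (F h) \<le> prob {S \<in> Pow E. S \<inter> A = h} * c"
      using prob_disjoint_events[OF A B AB, of "\<lambda>S. S = h" "Q h"] bound[of h]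
      by (simp add: F_def mult_left_mono)
  qed
  also have "\<dots> = (\<Sum>h\<in>Pow A. prob {S \<in> Pow E. S \<inter> A = h}) * c" by (simp add: sum_distrib_right)
  also have "(\<Sum>h\<in>Pow A. prob {S \<in> Pow E. S \<inter> A = h}) = prob (\<Union>h\<in>Pow A. {S \<in> Pow E. S \<inter> A = h})"
    using A local_event_measurable[OF A, of "\<lambda>S. S = h" for h]
    by (intro finite_measure_finite_Union[symmetric]) (auto simp: disjoint_family_on_def)
  also have "(\<Union>h\<in>Pow A. {S \<in> Pow E. S \<inter> A = h}) = Pow E" by auto
  also have "prob (Pow E) = 1" using prob_space by simp
  finally show ?thesis by simp
qed

text \<open>Chebyshev's inequality: disjoint edges are uncorrelated by 1-independence, and every
  other covariance is at most 1. The index set \<open>P\<close> allows repeated edges, since an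
  ordered count meets each edge in both directions.\<close>

lemma few_edges_prob:
  fixes ed :: "'i \<Rightarrow> 'v set"
  assumes fin: "finite P" and ed: "ed ` P \<subseteq> E" and a: "0 < a"
  shows "prob {S \<in> Pow E. real (card {s \<in> P. ed s \<in> S}) < p * real (card P) - a}
      \<le> real (card {(s, t) \<in> P \<times> P. ed s \<inter> ed t \<noteq> {}}) / a ^ 2"
proof -
  define X where "X s S = indicator (edge_event E (ed s)) S - p" for s S
  have [measurable]: "edge_event E (ed s) \<in> events" if "s \<in> P" for s
    using that ed by (auto intro: edge_event_sets)
  have int: "integrable \<mu> (\<lambda>S. X s S * X t S)" if "s \<in> P" "t \<in> P" for s t
  proof (rule integrable_const_bound[where B = "(1 + \<bar>p\<bar>) * (1 + \<bar>p\<bar>)"])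
    have "\<bar>X r S\<bar> \<le> 1 + \<bar>p\<bar>" for r S by (auto simp: X_def indicator_def)
    then show "AE S in \<mu>. norm (X s S * X t S) \<le> (1 + \<bar>p\<bar>) * (1 + \<bar>p\<bar>)"
      by (intro AE_I2) (auto simp: abs_mult intro!: mult_mono)
    show "(\<lambda>S. X s S * X t S) \<in> borel_measurable \<mu>"
      using that unfolding X_def by measurable
  qed
  have bound: "expectation (\<lambda>S. X s S * X t S) \<le> (if ed s \<inter> ed t \<noteq> {} then 1 else 0)"
    if st: "s \<in> P" "t \<in> P" for s t
  proof (cases "ed s \<inter> ed t = {}")
    case False
    have "0 \<le> p" "p \<le> 1" using p_bounds st ed by auto
    then have "\<bar>X r S\<bar> \<le> 1" for r S by (auto simp: X_def indicator_def)
    then have "\<bar>X s S\<bar> * \<bar>X t S\<bar> \<le> 1 * 1" for S by (intro mult_mono) auto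
    then have "X s S * X t S \<le> 1" for S
      using abs_le_D1[of "X s S * X t S" 1] by (simp only: abs_mult mult_1)
    then have "expectation (\<lambda>S. X s S * X t S) \<le> expectation (\<lambda>S. 1)"
      using int[OF st] by (intro integral_mono) auto
    then show ?thesis using False prob_space by simp
  next
    case True
    have e: "ed s \<in> E" "ed t \<in> E" using st ed by auto
    have "prob {S \<in> Pow E. ed s \<in> S \<inter> {ed s} \<and> ed t \<in> S \<inter> {ed t}}
        = prob {S \<in> Pow E. ed s \<in> S \<inter> {ed s}} * prob {S \<in> Pow E. ed t \<in> S \<inter> {ed t}}"
      using e True by (intro prob_disjoint_events[where Q = "\<lambda>S. ed s \<in> S" and R = "\<lambda>S. ed t \<in> S"]) auto
    then have pr: "prob (edge_event E (ed s) \<inter> edge_event E (ed t)) = p * p"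
      using prob_edge_event[OF e(1)] prob_edge_event[OF e(2)]
      by (simp add: edge_event_def Int_def conj_commute conj_left_commute cong: conj_cong)
    have "X s S * X t S = indicator (edge_event E (ed s) \<inter> edge_event E (ed t)) S
        - p * indicator (edge_event E (ed s)) S - p * indicator (edge_event E (ed t)) S + p * p" for S
      by (auto simp: X_def indicator_def algebra_simps)
    moreover have Pow: "edge_event E a \<inter> Pow E = edge_event E a" for a by (auto simp: edge_event_def)
    moreover have "integrable \<mu> (indicator A :: _ \<Rightarrow> real)" if "A \<in> events" for A
      using that by (simp add: emeasure_eq_measure)
    moreover have "edge_event E (ed s) \<inter> edge_event E (ed t) \<in> events"
      using e by (intro sets.Int edge_event_sets)
    ultimately have "expectation (\<lambda>S. X s S * X t S) = p * p - p * p - p * p + p * p"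
      using pr prob_edge_event[OF e(1)] prob_edge_event[OF e(2)] edge_event_sets[OF e(1)]
        edge_event_sets[OF e(2)] prob_space Pow by (simp add: Int_assoc)
    then show ?thesis by simp
  qed
  define W where "W S = (\<Sum>s\<in>P. X s S)" for S
  have W: "W S = real (card {s \<in> P. ed s \<in> S}) - p * real (card P)" if "S \<in> Pow E" for S
  proof -
    have "(\<Sum>s\<in>P. indicator (edge_event E (ed s)) S) = (\<Sum>s\<in>P. if ed s \<in> S then 1 else 0 :: real)"
      using that by (intro sum.cong) (auto simp: edge_event_def)
    also have "\<dots> = real (card {s \<in> P. ed s \<in> S})"
      using fin by (simp add: sum.If_cases Int_def)
    finally show ?thesis unfolding W_def X_def by (simp add: sum_subtractf)
  qed
  have W2: "(W S) ^ 2 = (\<Sum>s\<in>P. \<Sum>t\<in>P. X s S * X t S)" for S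
    unfolding W_def power2_eq_square by (rule sum_product)
  have intW: "integrable \<mu> (\<lambda>S. (W S) ^ 2)"
    unfolding W2 using int by (intro Bochner_Integration.integrable_sum) auto
  have "expectation (\<lambda>S. (W S) ^ 2) = (\<Sum>s\<in>P. \<Sum>t\<in>P. expectation (\<lambda>S. X s S * X t S))"
    unfolding W2 using int
    by (subst Bochner_Integration.integral_sum; (intro Bochner_Integration.integrable_sum sum.cong refl)?)
       (auto simp: Bochner_Integration.integral_sum)
  also have "\<dots> \<le> (\<Sum>s\<in>P. \<Sum>t\<in>P. if ed s \<inter> ed t \<noteq> {} then 1 else 0)"
    using bound by (intro sum_mono) auto
  also have "\<dots> = (\<Sum>x\<in>P \<times> P. if ed (fst x) \<inter> ed (snd x) \<noteq> {} then 1 else 0)"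
    by (simp add: sum.cartesian_product case_prod_unfold)
  also have "\<dots> = real (card {(s, t) \<in> P \<times> P. ed s \<inter> ed t \<noteq> {}})"
    using fin by (simp add: sum.If_cases Int_def case_prod_unfold mem_Times_iff)
  finally have exp: "expectation (\<lambda>S. (W S) ^ 2) \<le> real (card {(s, t) \<in> P \<times> P. ed s \<inter> ed t \<noteq> {}})" .
  have "{S \<in> Pow E. real (card {s \<in> P. ed s \<in> S}) < p * real (card P) - a} \<subseteq> {S \<in> space \<mu>. a ^ 2 \<le> (W S) ^ 2}"
  proof
    fix S assume S: "S \<in> {S \<in> Pow E. real (card {s \<in> P. ed s \<in> S}) < p * real (card P) - a}"
    then have "W S < - a" using W by auto
    then have "a ^ 2 \<le> (- W S) ^ 2" using a by (intro power_mono) auto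
    then show "S \<in> {S \<in> space \<mu>. a ^ 2 \<le> (W S) ^ 2}" using S by simp
  qed
  then have "prob {S \<in> Pow E. real (card {s \<in> P. ed s \<in> S}) < p * real (card P) - a}
      \<le> prob {S \<in> space \<mu>. a ^ 2 \<le> (W S) ^ 2}"
  proof (rule finite_measure_mono)
    have [measurable]: "(\<lambda>S. (W S) ^ 2) \<in> borel_measurable \<mu>" using intW by (rule borel_measurable_integrable)
    show "{S \<in> space \<mu>. a ^ 2 \<le> (W S) ^ 2} \<in> events" by measurable
  qed
  also have "\<dots> \<le> expectation (\<lambda>S. (W S) ^ 2) / a ^ 2"
    using intW a by (intro integral_Markov_inequality_measure[where A = "{}"]) auto
  also have "\<dots> \<le> real (card {(s, t) \<in> P \<times> P. ed s \<inter> ed t \<noteq> {}}) / a ^ 2"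
    using exp by (intro divide_right_mono) auto
  finally show ?thesis .
qed

text \<open>One-dependent events of failure probability at most \<open>1/4\<close> can all be avoided, since conditioning
  on the previous ones at most doubles the failure probability.\<close>

lemma one_dependent_chain:
  assumes good: "\<And>i. {S \<in> Pow E. good i S} \<in> events"
    and bad: "\<And>i. prob {S \<in> Pow E. \<not> good i S} \<le> 1 / 4"
    and indep: "\<And>k. prob {S \<in> Pow E. (\<forall>i<k. good i S) \<and> \<not> good (Suc k) S}
       = prob {S \<in> Pow E. \<forall>i<k. good i S} * prob {S \<in> Pow E. \<not> good (Suc k) S}"
  shows "0 < prob {S \<in> Pow E. \<forall>i<k::nat. good i S}"
proof -
  define A where "A k = {S \<in> Pow E. \<forall>i<k. good i S}" for k
  define B where "B k = {S \<in> Pow E. \<not> good k S}" for k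
  have A: "A k \<in> events" for k
  proof -
    have "{S \<in> space \<mu>. \<forall>i\<in>{..<k}. good i S} \<in> events"
      using good by (intro sets.sets_Collect_finite_All) auto
    then show ?thesis by (simp add: A_def Ball_def)
  qed
  have B: "B k \<in> events" for k
  proof -
    have "space \<mu> - {S \<in> Pow E. good k S} \<in> events" using good by (rule sets.compl_sets)
    also have "space \<mu> - {S \<in> Pow E. good k S} = B k" by (auto simp: B_def)
    finally show ?thesis .
  qed
  have step: "prob (A (Suc k)) = prob (A k) - prob (A k \<inter> B k)" for k
  proof -
    have "A (Suc k) = A k - (A k \<inter> B k)" by (auto simp: A_def B_def less_Suc_eq)
    then show ?thesis using A B by (simp add: finite_measure_Diff)
  qed
  \<comment> \<open>The event \<open>B (Suc k)\<close> is independent of \<open>A k\<close>, though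
    perhaps not of \<open>A (Suc k)\<close>. The carried ratio replaces \<open>prob (A k)\<close> by
    \<open>2 * prob (A (Suc k))\<close>, so the conditional failure probability is at most
    \<open>2 * (1 / 4) = 1 / 2\<close> and the ratio reproduces itself.\<close>
  have "0 < prob (A k) \<and> prob (A k) \<le> 2 * prob (A (Suc k))"
  proof (induction k)
    case 0
    have "A 0 = space \<mu>" by (auto simp: A_def)
    then have "prob (A 0) = 1" using prob_space by simp
    moreover have "prob (A 0 \<inter> B 0) \<le> prob (B 0)" using B by (intro finite_measure_mono) auto
    ultimately show ?case using step[of 0] bad[of 0] by (simp add: B_def)
  next
    case (Suc k)
    have "A (Suc k) \<inter> B (Suc k) \<subseteq> {S \<in> Pow E. (\<forall>i<k. good i S) \<and> \<not> good (Suc k) S}"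
      by (auto simp: A_def B_def)
    moreover have "{S \<in> Pow E. (\<forall>i<k. good i S) \<and> \<not> good (Suc k) S} = A k \<inter> B (Suc k)"
      by (auto simp: A_def B_def)
    ultimately have "prob (A (Suc k) \<inter> B (Suc k)) \<le> prob (A k) * prob (B (Suc k))"
      using indep[of k] A B by (metis A_def B_def finite_measure_mono sets.Int)
    also have "\<dots> \<le> prob (A k) * (1 / 4)"
      using bad[of "Suc k"] by (intro mult_left_mono) (auto simp: B_def)
    finally show ?case using step[of "Suc k"] Suc by linarith
  qed
  then show ?thesis by (simp add: A_def)
qed

end

section \<open>Layers and rungs\<close>

definition adj :: "'v set set \<Rightarrow> 'v \<Rightarrow> 'v \<Rightarrow> bool" where
  "adj S x y \<longleftrightarrow> {x, y} \<in> S"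

lemma has_path_mono: "has_path S m \<Longrightarrow> l \<le> m \<Longrightarrow> has_path S l"
  unfolding has_path_def
proof (elim exE conjE)
  fix vs assume vs: "length vs = Suc m" "distinct vs" "\<forall>i<m. {vs ! i, vs ! Suc i} \<in> S" and "l \<le> m"
  then show "\<exists>vs. length vs = Suc l \<and> distinct vs \<and> (\<forall>i<l. {vs ! i, vs ! Suc i} \<in> S)"
    by (intro exI[of _ "take (Suc l) vs"]) auto
qed

text \<open>A shortest walk repeats no vertex, as the part between two visits could be cut out. Its
  length is exported together with the walk, so that the layers it crosses bound the length from
  below.\<close>

lemma has_path_of_reachable:
  assumes reach: "(adj S)\<^sup>*\<^sup>* x y" and "x \<noteq> y"
  obtains m where "has_path S m" "(adj S ^^ m) x y"
proof -
  obtain m0 where "(adj S ^^ m0) x y" using reach by (auto simp: rtranclp_power)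
  define m where "m = (LEAST m. (adj S ^^ m) x y)"
  have m: "(adj S ^^ m) x y" unfolding m_def by (rule LeastI) fact
  have least: "m \<le> k" if "(adj S ^^ k) x y" for k unfolding m_def using that by (rule Least_le)
  obtain f where f: "f 0 = x" "f m = y" "\<And>i. i < m \<Longrightarrow> adj S (f i) (f (Suc i))"
    using m by (auto simp: relpowp_fun_conv)
  have seg: "(adj S ^^ (j - i)) (f i) (f j)" if "i \<le> j" "j \<le> m" for i j
    unfolding relpowp_fun_conv
    by (rule exI[of _ "\<lambda>k. f (i + k)"]) (use that f(3) in auto)
  have "f i \<noteq> f j" if "i < j" "j \<le> m" for i j
  proof
    assume eq: "f i = f j"
    have "(adj S ^^ i) x (f i)" using seg[of 0 i] that f(1) by simp
    moreover have "(adj S ^^ (m - j)) (f i) y" using seg[of j m] that f(2) eq by simp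
    ultimately have "(adj S ^^ (i + (m - j))) x y" by (auto simp: relpowp_add)
    then have "m \<le> i + (m - j)" by (rule least)
    then show False using that by simp
  qed
  then have "inj_on f {..m}" by (intro linorder_inj_onI') auto
  moreover have "set [0..<Suc m] = {..m}" by (simp only: set_upt atLeast0LessThan lessThan_Suc_atMost)
  ultimately have "distinct (map f [0..<Suc m])" by (simp only: distinct_map distinct_upt)
  then have "has_path S m"
    unfolding has_path_def using f(3)
    by (intro exI[of _ "map f [0..<Suc m]"]) (simp add: adj_def del: upt_Suc)
  then show ?thesis using that m by blast
qed

context finite_graph
begin

text \<open>Disjoint sets of layers give edge sets that span disjoint vertex sets, the situation in
  which 1-independence applies. A single layer carries no rungs.\<close>

definition edges_on :: "int set \<Rightarrow> (int \<times> nat) set set" where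
  "edges_on I = {e \<in> Z_times_edges G n. fst ` e \<subseteq> I}"

lemma edges_on_subset: "edges_on I \<subseteq> Z_times_edges G n"
  by (auto simp: edges_on_def)

lemma Z_edge_vertices: "e \<in> Z_times_edges G n \<Longrightarrow> x \<in> e \<Longrightarrow> snd x < n"
  unfolding Z_times_edges_def by auto

lemma finite_edges_on: "finite I \<Longrightarrow> finite (edges_on I)"
proof -
  assume "finite I"
  moreover have "edges_on I \<subseteq> Pow (I \<times> {..<n})"
    using Z_edge_vertices by (fastforce simp: edges_on_def)
  ultimately show ?thesis by (meson finite_Pow_iff finite_SigmaI finite_lessThan finite_subset)
qed

lemma edges_on_disjoint: "I \<inter> J = {} \<Longrightarrow> \<Union>(edges_on I) \<inter> \<Union>(edges_on J) = {}"
  by (fastforce simp: edges_on_def)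

text \<open>The conjunct \<open>G u v\<close> makes this a subgraph of \<open>G\<close> for every
  \<open>S\<close> whatsoever, including configurations frozen by conditioning.\<close>

definition layer :: "int \<Rightarrow> (int \<times> nat) set set \<Rightarrow> nat \<Rightarrow> nat \<Rightarrow> bool" where
  "layer i S u v \<longleftrightarrow> G u v \<and> {(i, u), (i, v)} \<in> S"

definition rungs :: "int \<Rightarrow> (int \<times> nat) set set \<Rightarrow> nat set" where
  "rungs i S = {u. u < n \<and> {(i, u), (i + 1, u)} \<in> S}"

lemma layer_edge: "G u v \<Longrightarrow> {(i, u), (i, v)} \<in> edges_on I \<longleftrightarrow> i \<in> I"
  using graph[of u v] by (auto simp: edges_on_def Z_times_edges_def)

lemma rung_edge: "u < n \<Longrightarrow> {(i, u), (i + 1, u)} \<in> edges_on I \<longleftrightarrow> i \<in> I \<and> i + 1 \<in> I"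
  by (auto simp: edges_on_def Z_times_edges_def)

lemma layer_local: "i \<in> I \<Longrightarrow> layer i (S \<inter> edges_on I) = layer i S"
  by (auto simp: layer_def layer_edge fun_eq_iff)

lemma rungs_local: "i \<in> I \<Longrightarrow> i + 1 \<in> I \<Longrightarrow> rungs i (S \<inter> edges_on I) = rungs i S"
  by (auto simp: rungs_def rung_edge)

lemma adj_layer_change:
  assumes "S \<subseteq> Z_times_edges G n" "(adj S ^^ m) x y"
  shows "\<bar>fst x - fst y\<bar> \<le> int m"
  using assms(2)
proof (induction m arbitrary: y)
  case (Suc m)
  then obtain z where z: "(adj S ^^ m) x z" "adj S z y" by auto
  then have "{z, y} \<in> Z_times_edges G n" using assms(1) by (auto simp: adj_def)
  then have "\<bar>fst z - fst y\<bar> \<le> 1" by (auto simp: Z_times_edges_def doubleton_eq_iff)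
  then show ?case using Suc.IH[OF z(1)] by linarith
qed auto

end

context one_independent_model
begin

text \<open>A countable union over vertex lists, each contributing a finite intersection of edge
  events.\<close>

lemma has_path_measurable:
  fixes l :: nat
  assumes "countable (UNIV :: 'v set)"
  shows "{S \<in> Pow E. has_path S l} \<in> events"
proof -
  have edge: "{S \<in> space \<mu>. e \<in> S} \<in> events" for e
  proof (cases "e \<in> E")
    case True
    then show ?thesis using edge_event_sets[of e] by (simp add: edge_event_def Pow_def)
  next
    case False
    then have "{S \<in> space \<mu>. e \<in> S} = {}" by auto
    then show ?thesis by (simp only: sets.empty_sets)
  qed
  let ?L = "{vs :: 'v list. length vs = Suc l \<and> distinct vs}"
  have "countable ?L"
    using countable_lists[OF assms] by (rule countable_subset[rotated]) auto
  then have "{S \<in> space \<mu>. \<exists>vs\<in>?L. \<forall>i\<in>{..<l}. {vs ! i, vs ! Suc i} \<in> S} \<in> events"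
    using edge by (intro sets.sets_Collect_countable_Ex' sets.sets_Collect_finite_All) auto
  also have "{S \<in> space \<mu>. \<exists>vs\<in>?L. \<forall>i\<in>{..<l}. {vs ! i, vs ! Suc i} \<in> S} = {S \<in> Pow E. has_path S l}"
    by (auto simp: has_path_def)
  finally show ?thesis .
qed

end

section \<open>Probability that consecutive layers are linked\<close>

locale quasirandom_model = quasirandom G n q \<delta> + one_independent_model "Z_times_edges G n" p \<mu>
  for G n q \<delta> p \<mu> +
  assumes \<delta>_le_1: "\<delta> \<le> 1"
begin

abbreviation "E \<equiv> Z_times_edges G n"

lemma p01: "0 \<le> p" "p \<le> 1"
proof -
  have "{(0, 0), (0 + 1, 0)} \<in> E" using n_pos unfolding Z_times_edges_def by blast
  then have "E \<noteq> {}" by blast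
  then show "0 \<le> p" "p \<le> 1" using p_bounds by auto
qed

lemma subgraph_layer: "subgraph (layer i S)"
  using graph by (auto simp: subgraph_def layer_def insert_commute)

lemma card_pairs_le_3: "real (card (pairs G X Y)) \<le> 3 * (q * real n ^ 2)"
proof -
  have "pairs G X Y \<subseteq> pairs G {..<n} {..<n}" using graph by (auto simp: pairs_def)
  then have "card (pairs G X Y) \<le> card (pairs G {..<n} {..<n})" by (intro card_mono) auto
  moreover have "err \<le> q * real n ^ 2"
    unfolding err_def using \<delta>_le_1 q_pos mult_right_mono[of \<delta> 1 "q * real n ^ 2"] by simp
  ultimately show ?thesis using pairs_self_approx[of "{..<n}"] by simp
qed

lemma atypical_measurable: "{S \<in> Pow E. \<not> typical p (layer i S) X Y} \<in> events"
  using local_event_measurable[OF finite_edges_on edges_on_subset, of "{i}" "\<lambda>S. \<not> typical p (layer i S) X Y"]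
  by (simp add: layer_local)

text \<open>Each of the at most \<open>3 * q * n ^ 2\<close> pairs meets at most
  \<open>4 * n\<close> others, so the variance is at most \<open>12 * q * n ^ 3\<close>. Compared
  with \<open>err ^ 2\<close> this is small as soon as \<open>n * q\<close> is large.\<close>

lemma atypical_prob:
  assumes XY: "X \<subseteq> {..<n}" "Y \<subseteq> {..<n}"
  shows "prob {S \<in> Pow E. \<not> typical p (layer i S) X Y} \<le> 12 / (\<delta> ^ 2 * (real n * q))"
proof -
  define P where "P = pairs G X Y"
  define ed where "ed s = {(i, fst s), (i, snd s)}" for s :: "nat \<times> nat"
  have fin: "finite P" using XY finite_subset unfolding P_def by (blast intro: finite_pairs)
  have "ed ` P \<subseteq> E"
    using layer_edge[of _ _ i UNIV] edges_on_subset[of UNIV] by (auto simp: ed_def P_def pairs_def)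
  note le = few_edges_prob[OF fin this err_pos]
  have "pairs (layer i S) X Y = {s \<in> P. ed s \<in> S}" for S
    by (auto simp: pairs_def P_def layer_def ed_def)
  then have 1: "{S \<in> Pow E. \<not> typical p (layer i S) X Y}
      = {S \<in> Pow E. real (card {s \<in> P. ed s \<in> S}) < p * real (card P) - err}"
    by (auto simp: typical_def P_def)
  have "{(s, t) \<in> P \<times> P. ed s \<inter> ed t \<noteq> {}}
      \<subseteq> (SIGMA s:P. {fst s, snd s} \<times> {..<n} \<union> {..<n} \<times> {fst s, snd s})"
    using graph by (fastforce simp: ed_def P_def pairs_def)
  then have "card {(s, t) \<in> P \<times> P. ed s \<inter> ed t \<noteq> {}}
      \<le> card (SIGMA s:P. {fst s, snd s} \<times> {..<n} \<union> {..<n} \<times> {fst s, snd s})"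
    using fin by (intro card_mono finite_SigmaI) auto
  also have "\<dots> = (\<Sum>s\<in>P. card ({fst s, snd s} \<times> {..<n} \<union> {..<n} \<times> {fst s, snd s}))"
    using fin by (intro card_SigmaI) auto
  also have "\<dots> \<le> (\<Sum>s\<in>P. 4 * n)"
  proof (rule sum_mono)
    fix s :: "nat \<times> nat"
    have "card {fst s, snd s} \<le> 2" by (simp add: card_insert_if)
    then have "card ({fst s, snd s} \<times> {..<n}) \<le> 2 * n" "card ({..<n} \<times> {fst s, snd s}) \<le> 2 * n"
      by (simp_all add: card_cartesian_product)
    then show "card ({fst s, snd s} \<times> {..<n} \<union> {..<n} \<times> {fst s, snd s}) \<le> 4 * n"
      using card_Un_le[of "{fst s, snd s} \<times> {..<n}" "{..<n} \<times> {fst s, snd s}"] by linarith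
  qed
  also have "\<dots> = card P * (4 * n)" by simp
  finally have "real (card {(s, t) \<in> P \<times> P. ed s \<inter> ed t \<noteq> {}}) \<le> real (card P * (4 * n))"
    by (simp only: of_nat_le_iff)
  also have "\<dots> = real (card P) * (4 * real n)" by simp
  also have "\<dots> \<le> 3 * (q * real n ^ 2) * (4 * real n)"
    using card_pairs_le_3 unfolding P_def by (intro mult_right_mono) auto
  finally have "real (card {(s, t) \<in> P \<times> P. ed s \<inter> ed t \<noteq> {}}) / err ^ 2
      \<le> 3 * (q * real n ^ 2) * (4 * real n) / err ^ 2"
    by (intro divide_right_mono) auto
  also have "\<dots> = 12 / (\<delta> ^ 2 * (real n * q))"
    using n_pos q_pos \<delta>_pos unfolding err_def by (simp add: field_simps power2_eq_square)
  finally show ?thesis unfolding 1 using le by linarith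
qed

text \<open>Here \<open>H\<close> is a fixed graph; it becomes the random other layer in
  \<open>bad_prob\<close>.\<close>

lemma not_fully_typical_prob:
  assumes H: "subgraph H"
  shows "prob {S \<in> Pow E. \<not> fully_typical p b H (layer i S)}
    \<le> (2 ^ b + 2) * (24 / (\<delta> ^ 2 * (real n * q)))"
proof -
  define B where "B X Y = {S \<in> Pow E. \<not> typical p (layer i S) X Y}" for X Y
  define c where "c = 12 / (\<delta> ^ 2 * (real n * q))"
  have c: "0 \<le> c" using q_pos by (simp add: c_def)
  have B: "B X Y \<in> events" for X Y unfolding B_def by (rule atypical_measurable)
  have "{S \<in> Pow E. \<not> fully_typical p b H (layer i S)} = (\<Union>X\<in>probes H n b. B X X \<union> B X {..<n})"
    by (auto simp: fully_typical_def B_def)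
  then have "prob {S \<in> Pow E. \<not> fully_typical p b H (layer i S)}
      \<le> (\<Sum>X\<in>probes H n b. prob (B X X \<union> B X {..<n}))"
    using B by (auto intro!: finite_measure_subadditive_finite)
  also have "\<dots> \<le> (\<Sum>X\<in>probes H n b. 2 * c)"
  proof (rule sum_mono)
    fix X assume "X \<in> probes H n b"
    then have "X \<subseteq> {..<n}" by (rule probes_subset)
    then have "prob (B X X) \<le> c" "prob (B X {..<n}) \<le> c"
      unfolding B_def c_def by (intro atypical_prob; simp)+
    then show "prob (B X X \<union> B X {..<n}) \<le> 2 * c"
      using measure_Un_le[OF B B, of X X X "{..<n}"] by linarith
  qed
  also have "\<dots> = real (card (probes H n b)) * (2 * c)" by simp
  also have "\<dots> \<le> real (2 ^ b + 2) * (2 * c)"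
  proof (rule mult_right_mono)
    have "card (probes H n b) \<le> 2 ^ b + 2" using subgraph_sym[OF H] n_pos by (rule card_probes)
    then show "real (card (probes H n b)) \<le> real (2 ^ b + 2)" by (simp only: of_nat_le_iff)
  qed (use c in simp)
  finally show ?thesis by (simp add: c_def add.commute)
qed

text \<open>Rungs between the same two layers are pairwise disjoint, so only the \<open>n\<close>
  diagonal terms enter the variance.\<close>

lemma few_rungs_prob: "prob {S \<in> Pow E. real (card (rungs i S)) < (p - \<delta>) * real n} \<le> 1 / (\<delta> ^ 2 * real n)"
proof -
  define ed where "ed u = {(i, u), (i + 1, u)}" for u :: nat
  have "ed ` {..<n} \<subseteq> E"
    using rung_edge[of _ i UNIV] edges_on_subset[of UNIV] by (auto simp: ed_def)
  moreover have "0 < \<delta> * real n" using \<delta>_pos n_pos by simp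
  ultimately have "prob {S \<in> Pow E. real (card {s \<in> {..<n}. ed s \<in> S}) < p * real (card {..<n}) - \<delta> * real n}
      \<le> real (card {(s, t) \<in> {..<n} \<times> {..<n}. ed s \<inter> ed t \<noteq> {}}) / (\<delta> * real n) ^ 2"
    by (intro few_edges_prob) auto
  moreover have "{(s, t) \<in> {..<n} \<times> {..<n}. ed s \<inter> ed t \<noteq> {}} = (\<lambda>s. (s, s)) ` {..<n}"
    by (auto simp: ed_def)
  moreover have "card ((\<lambda>s. (s, s)) ` {..<n}) = n" by (subst card_image) (auto simp: inj_on_def)
  moreover have "rungs i S = {s \<in> {..<n}. ed s \<in> S}" for S by (auto simp: rungs_def ed_def)
  moreover have "real n / (\<delta> * real n) ^ 2 = 1 / (\<delta> ^ 2 * real n)"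
    using n_pos \<delta>_pos by (simp add: field_simps power2_eq_square)
  ultimately show ?thesis by (simp add: left_diff_distrib)
qed

text \<open>This supplies the typicality and rung hypotheses of \<open>two_layers\<close> and looks
  at the layers \<open>i\<close> and \<open>i + 1\<close> only, which makes the events
  one-dependent.\<close>

definition good :: "nat \<Rightarrow> int \<Rightarrow> (int \<times> nat) set set \<Rightarrow> bool" where
  "good b i S \<longleftrightarrow> fully_typical p b (layer i S) (layer (i + 1) S)
     \<and> fully_typical p b (layer (i + 1) S) (layer i S) \<and> (p - \<delta>) * real n \<le> real (card (rungs i S))"

lemma good_local: "i \<in> I \<Longrightarrow> i + 1 \<in> I \<Longrightarrow> good b i (S \<inter> edges_on I) = good b i S"
  by (simp add: good_def layer_local rungs_local)

lemma good_measurable: "{S \<in> Pow E. good b i S} \<in> events"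
  using local_event_measurable[OF finite_edges_on edges_on_subset, of "{i, i + 1}" "good b i"]
  by (simp add: good_local)

lemma bad_prob:
  "prob {S \<in> Pow E. \<not> good b i S}
    \<le> 48 * (2 ^ b + 2) / (\<delta> ^ 2 * (real n * q)) + 1 / (\<delta> ^ 2 * real n)"
proof -
  define c where "c = (2 ^ b + 2) * (24 / (\<delta> ^ 2 * (real n * q)))"
  define B where "B j k = {S \<in> Pow E. \<not> fully_typical p b (layer j S) (layer k S)}" for j k
  define R where "R = {S \<in> Pow E. real (card (rungs i S)) < (p - \<delta>) * real n}"
  have B_events: "B j k \<in> events" for j k
    using local_event_measurable[OF finite_edges_on edges_on_subset, of "{j, k}"
        "\<lambda>S. \<not> fully_typical p b (layer j S) (layer k S)"]
    by (simp add: B_def layer_local)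
  have R_events: "R \<in> events"
    using local_event_measurable[OF finite_edges_on edges_on_subset, of "{i, i + 1}"
        "\<lambda>S. real (card (rungs i S)) < (p - \<delta>) * real n"]
    by (simp add: R_def rungs_local)
  have B_le: "prob (B j k) \<le> c" if "j \<noteq> k" for j k
  proof -
    \<comment> \<open>The probes are read off layer \<open>j\<close> and the counts off layer
      \<open>k\<close>, so layer \<open>j\<close> may be frozen.\<close>
    have "prob {S \<in> Pow E. \<not> fully_typical p b (layer j (S \<inter> edges_on {j})) (layer k (S \<inter> edges_on {k}))} \<le> c"
    proof (rule prob_conditional_bound[OF finite_edges_on edges_on_subset finite_edges_on edges_on_subset
            edges_on_disjoint])
      fix h
      show "prob {S \<in> Pow E. \<not> fully_typical p b (layer j h) (layer k (S \<inter> edges_on {k}))} \<le> c"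
        using not_fully_typical_prob[OF subgraph_layer, of b j h k] by (simp add: layer_local c_def)
    qed (use that in auto)
    then show ?thesis by (simp add: B_def layer_local)
  qed
  have "{S \<in> Pow E. \<not> good b i S} = (B i (i + 1) \<union> B (i + 1) i) \<union> R"
    by (auto simp: good_def B_def R_def)
  then have "prob {S \<in> Pow E. \<not> good b i S} \<le> prob (B i (i + 1) \<union> B (i + 1) i) + prob R"
    using measure_Un_le[OF sets.Un[OF B_events B_events] R_events] by simp
  also have "\<dots> \<le> (prob (B i (i + 1)) + prob (B (i + 1) i)) + prob R"
    using measure_Un_le[OF B_events B_events] by simp
  also have "\<dots> \<le> (c + c) + 1 / (\<delta> ^ 2 * real n)"
    using few_rungs_prob[of i] by (intro add_mono B_le) (auto simp: R_def)
  finally show ?thesis by (simp add: c_def algebra_simps)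
qed

text \<open>The label handed to \<open>two_layers\<close> is reachability from a vertex of the
  majority component of layer 0. The range of \<open>good\<close> includes \<open>l\<close> itself,
  from which the majority component of layer \<open>l\<close> is obtained.\<close>

lemma good_chain_reachable:
  assumes b: "0 < b" and p: "p0 < p" and \<eta>: "0 < \<eta>"
    and sl: "slack b \<le> (p - p0) * \<eta> ^ 2" "slack b < (p - 1 / 2) * \<eta>" "slack b < p - 1 / 2"
    and \<eta>\<delta>: "10 * \<eta> + \<delta> < p - p0"
    and good: "\<And>i. i < Suc l \<Longrightarrow> good b (int i) S"
  shows "\<exists>a c. (adj S)\<^sup>*\<^sup>* (0, a) (int l, c)"
proof -
  have V: "{..<n} \<in> probes H n b" for H by (simp add: probes_def)
  have maj: "\<exists>C\<in>comps (layer (int i) S) n. n < 2 * card C" if "i \<le> l" for i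
    using good[of i] that V sl(3) p01 b
    by (intro exists_majority_component[OF subgraph_layer]) (auto simp: good_def fully_typical_def)
  have intra: "adj S (i, u) (i, v)" "adj S (i, v) (i, u)" if "layer i S u v" for i u v
    using that by (auto simp: layer_def adj_def insert_commute)
  have inter: "adj S (i, u) (i + 1, u)" "adj S (i + 1, u) (i, u)" if "u \<in> rungs i S" for i u
    using that by (auto simp: rungs_def adj_def insert_commute)
  obtain C0 where C0: "C0 \<in> comps (layer 0 S) n" "n < 2 * card C0" using maj[of 0] by auto
  then obtain a where a: "a \<in> C0" using n_pos by (cases "C0 = {}") auto
  have "\<exists>C\<in>comps (layer (int i) S) n. n < 2 * card C \<and> (\<exists>c\<in>C. (adj S)\<^sup>*\<^sup>* (0, a) (int i, c))"
    if "i \<le> l" for i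
    using that
  proof (induction i)
    case 0
    then show ?case using C0 a by auto
  next
    case (Suc i)
    then obtain C where C: "C \<in> comps (layer (int i) S) n" "n < 2 * card C"
      and reach: "\<exists>c\<in>C. (adj S)\<^sup>*\<^sup>* (0, a) (int i, c)" by auto
    obtain D where D: "D \<in> comps (layer (int i + 1) S) n" "n < 2 * card D"
      using maj[OF Suc.prems] by (auto simp: add.commute)
    have g: "good b (int i) S" using good[of i] Suc.prems by simp
    have "\<exists>d\<in>D. (adj S)\<^sup>*\<^sup>* (0, a) (int i + 1, d)"
    proof (rule two_layers[OF subgraph_layer subgraph_layer b _ _ p p01(2) \<eta> sl(1,2) \<eta>\<delta> _ _ C D _ _ _ reach])
      show "fully_typical p b (layer (int i) S) (layer (int i + 1) S)"
        "fully_typical p b (layer (int i + 1) S) (layer (int i) S)"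
        "(p - \<delta>) * real n \<le> real (card (rungs (int i) S))"
        using g by (auto simp: good_def)
      show "rungs (int i) S \<subseteq> {..<n}" by (auto simp: rungs_def)
    qed (meson intra inter rtranclp.rtrancl_into_rtrancl)+
    then show ?case using D by (auto simp: add.commute)
  qed
  then show ?thesis by blast
qed

lemma long_paths:
  assumes b: "0 < b" and p: "p0 < p" and \<eta>: "0 < \<eta>"
    and sl: "slack b \<le> (p - p0) * \<eta> ^ 2" "slack b < (p - 1 / 2) * \<eta>" "slack b < p - 1 / 2"
    and \<eta>\<delta>: "10 * \<eta> + \<delta> < p - p0"
    and small: "48 * (2 ^ b + 2) / (\<delta> ^ 2 * (real n * q)) + 1 / (\<delta> ^ 2 * real n) \<le> 1 / 4"
  shows "0 < prob {S \<in> space \<mu>. has_path S l}"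
proof -
  \<comment> \<open>The chain leads to layer \<open>l + 1\<close>, so that its two ends differ even
    for \<open>l = 0\<close>.\<close>
  have "0 < prob {S \<in> Pow E. \<forall>i<Suc (Suc l). good b (int i) S}"
  proof (rule one_dependent_chain)
    show "{S \<in> Pow E. good b (int i) S} \<in> events" for i by (rule good_measurable)
    show "prob {S \<in> Pow E. \<not> good b (int i) S} \<le> 1 / 4" for i
      using bad_prob[of b "int i"] small by linarith
    fix k :: nat
    \<comment> \<open>\<open>good\<close> at the indices below \<open>k\<close> sees the layers up
      to \<open>k\<close>; at index \<open>k + 1\<close> it sees \<open>k + 1\<close> and
      \<open>k + 2\<close>.\<close>
    define I J where "I = {0..int k}" and "J = {int k + 1, int k + 2}"
    have "prob {S \<in> Pow E. (\<forall>i<k. good b (int i) (S \<inter> edges_on I)) \<and> \<not> good b (int (Suc k)) (S \<inter> edges_on J)}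
      = prob {S \<in> Pow E. \<forall>i<k. good b (int i) (S \<inter> edges_on I)} * prob {S \<in> Pow E. \<not> good b (int (Suc k)) (S \<inter> edges_on J)}"
      by (rule prob_disjoint_events[where Q = "\<lambda>S. \<forall>i<k. good b (int i) S" and R = "\<lambda>S. \<not> good b (int (Suc k)) S",
            OF finite_edges_on edges_on_subset finite_edges_on edges_on_subset edges_on_disjoint])
         (auto simp: I_def J_def)
    moreover have "good b (int i) (S \<inter> edges_on I) = good b (int i) S" if "i < k" for i S
      using that by (intro good_local) (auto simp: I_def)
    moreover have "good b (int (Suc k)) (S \<inter> edges_on J) = good b (int (Suc k)) S" for S
      by (intro good_local) (auto simp: J_def)
    ultimately show "prob {S \<in> Pow E. (\<forall>i<k. good b (int i) S) \<and> \<not> good b (int (Suc k)) S}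
       = prob {S \<in> Pow E. \<forall>i<k. good b (int i) S} * prob {S \<in> Pow E. \<not> good b (int (Suc k)) S}"
      by (simp cong: conj_cong)
  qed
  also have "\<dots> \<le> prob {S \<in> Pow E. has_path S l}"
  proof (rule finite_measure_mono)
    show "{S \<in> Pow E. has_path S l} \<in> events" by (rule has_path_measurable) simp
    show "{S \<in> Pow E. \<forall>i<Suc (Suc l). good b (int i) S} \<subseteq> {S \<in> Pow E. has_path S l}"
    proof safe
      fix S assume S: "S \<subseteq> E" and g: "\<forall>i<Suc (Suc l). good b (int i) S"
      obtain a c where ac: "(adj S)\<^sup>*\<^sup>* (0, a) (int (Suc l), c)"
        using good_chain_reachable[OF b p \<eta> sl \<eta>\<delta>, of "Suc l" S] g by blast
      have "(0, a) \<noteq> (int (Suc l), c)" by simp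
      then obtain m where m: "has_path S m" "(adj S ^^ m) (0, a) (int (Suc l), c)"
        using has_path_of_reachable[OF ac] by blast
      have "Suc l \<le> m" using adj_layer_change[OF S m(2)] by simp
      then show "has_path S l" using has_path_mono[OF m(1)] by simp
    qed
  qed
  finally show ?thesis by simp
qed

end

section \<open>Block factors of independent bits\<close>

definition bits :: "('i \<Rightarrow> real) \<Rightarrow> ('i \<Rightarrow> bool) measure" where
  "bits r = PiM UNIV (\<lambda>i. measure_pmf (bernoulli_pmf (r i)))"

lemma prob_space_bits: "prob_space (bits r)"
  unfolding bits_def by (intro prob_space_PiM prob_space_measure_pmf)

lemma space_bits [simp]: "space (bits r) = UNIV"
  by (simp add: bits_def space_PiM PiE_UNIV_domain)

text \<open>\<open>Q\<close> is a union of cylinders over the finitely many patterns on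
  \<open>J\<close>. The index set \<open>K\<close> is all of the bits in one use and the bits of
  some blocks in another.\<close>

lemma finitely_determined_measurable:
  fixes r :: "'i \<Rightarrow> real"
  assumes J: "finite J" "J \<subseteq> K" and det: "\<And>x y. (\<And>j. j \<in> J \<Longrightarrow> x j = y j) \<Longrightarrow> Q x \<longleftrightarrow> Q y"
  shows "{x \<in> space (PiM K (\<lambda>i. measure_pmf (bernoulli_pmf (r i)))). Q x}
    \<in> sets (PiM K (\<lambda>i. measure_pmf (bernoulli_pmf (r i))))"
proof -
  let ?M = "PiM K (\<lambda>i. measure_pmf (bernoulli_pmf (r i)))"
  let ?T = "{t \<in> J \<rightarrow>\<^sub>E (UNIV :: bool set). Q t}"
  have fin: "finite ?T"
  proof (rule finite_subset)
    show "finite (J \<rightarrow>\<^sub>E (UNIV :: bool set))" by (rule finite_PiE) (use J in auto)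
  qed auto
  have eq: "Q x \<longleftrightarrow> (\<exists>t\<in>?T. \<forall>j\<in>J. x j = t j)" for x
  proof
    assume "Q x"
    then have "Q (restrict x J)" using det[of x "restrict x J"] by simp
    then show "\<exists>t\<in>?T. \<forall>j\<in>J. x j = t j" by (intro bexI[of _ "restrict x J"]) auto
  next
    assume "\<exists>t\<in>?T. \<forall>j\<in>J. x j = t j"
    then obtain t where "Q t" "\<And>j. j \<in> J \<Longrightarrow> x j = t j" by auto
    then show "Q x" using det[of x t] by simp
  qed
  have "{x \<in> space ?M. \<exists>t\<in>?T. \<forall>j\<in>J. x j = t j} \<in> sets ?M"
  proof (intro sets.sets_Collect_finite_Ex sets.sets_Collect_finite_All fin J(1))
    fix t j assume "j \<in> J"
    then show "{x \<in> space ?M. x j = t j} \<in> sets ?M"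
      using J(2) sets_Collect_single'[of j K "\<lambda>i. measure_pmf (bernoulli_pmf (r i))" "\<lambda>b. b = t j"] by auto
  qed
  moreover have "{x \<in> space ?M. Q x} = {x \<in> space ?M. \<exists>t\<in>?T. \<forall>j\<in>J. x j = t j}"
    by (intro Collect_cong conj_cong refl eq)
  ultimately show ?thesis by (simp only:)
qed

lemma bits_component:
  fixes r :: "'i \<Rightarrow> real"
  shows "distr (bits r) (measure_pmf (bernoulli_pmf (r i))) (\<lambda>\<omega>. \<omega> i) = measure_pmf (bernoulli_pmf (r i))"
  unfolding bits_def by (rule distr_PiM_component) (simp_all add: prob_space_measure_pmf)

lemma bits_component_measurable:
  fixes r :: "'i \<Rightarrow> real"
  shows "(\<lambda>\<omega>. \<omega> i) \<in> measurable (bits r) (measure_pmf (bernoulli_pmf (r i)))"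
  unfolding bits_def by (rule measurable_component_singleton) simp

lemma indep_bits:
  fixes r :: "'i \<Rightarrow> real"
  shows "prob_space.indep_vars (bits r) (\<lambda>i. measure_pmf (bernoulli_pmf (r i))) (\<lambda>i \<omega>. \<omega> i) UNIV"
proof -
  let ?B = "\<lambda>i. measure_pmf (bernoulli_pmf (r i))"
  have "distr (bits r) (PiM UNIV ?B) (\<lambda>x. \<lambda>i\<in>UNIV. x i) = PiM UNIV (\<lambda>i. distr (bits r) (?B i) (\<lambda>\<omega>. \<omega> i))"
    unfolding bits_component restrict_UNIV by (simp add: bits_def)
  then show ?thesis
    by (rule iffD2[OF prob_space.indep_vars_iff_distr_eq_PiM[OF prob_space_bits UNIV_not_empty bits_component_measurable]])
qed

lemma measure_bits_cylinder:
  fixes r :: "'i \<Rightarrow> real"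
  assumes J: "finite J" "J \<noteq> {}" and r: "\<And>i. 0 \<le> r i" "\<And>i. r i \<le> 1"
  shows "measure (bits r) {\<omega>. \<forall>j\<in>J. \<omega> j = t j} = (\<Prod>j\<in>J. if t j then r j else 1 - r j)"
proof -
  let ?B = "\<lambda>i. measure_pmf (bernoulli_pmf (r i))"
  have "{\<omega>. \<forall>j\<in>J. \<omega> j = t j} = (\<Inter>j\<in>J. (\<lambda>\<omega>. \<omega> j) -` {t j} \<inter> space (bits r))" using J by auto
  then have "measure (bits r) {\<omega>. \<forall>j\<in>J. \<omega> j = t j}
      = (\<Prod>j\<in>J. measure (bits r) ((\<lambda>\<omega>. \<omega> j) -` {t j} \<inter> space (bits r)))"
    using prob_space.indep_varsD[OF prob_space_bits indep_bits J(2,1), of "\<lambda>j. {t j}"] by simp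
  also have "\<dots> = (\<Prod>j\<in>J. if t j then r j else 1 - r j)"
  proof (rule prod.cong)
    fix j
    have "measure (bits r) ((\<lambda>\<omega>. \<omega> j) -` {t j} \<inter> space (bits r)) = measure (distr (bits r) (?B j) (\<lambda>\<omega>. \<omega> j)) {t j}"
      by (rule measure_distr[OF bits_component_measurable, symmetric]) simp
    also have "\<dots> = pmf (bernoulli_pmf (r j)) (t j)"
      unfolding bits_component by (rule measure_pmf_single)
    finally show "measure (bits r) ((\<lambda>\<omega>. \<omega> j) -` {t j} \<inter> space (bits r)) = (if t j then r j else 1 - r j)"
      using r by simp
  qed simp
  finally show ?thesis .
qed

text \<open>Edges are functions of independent bits, and vertex-disjoint edges read disjoint sets of
  bits; this is the source of 1-independence.\<close>

locale block_factor =
  fixes E :: "'v set set" and r :: "'i \<Rightarrow> real" and open_edge :: "('i \<Rightarrow> bool) \<Rightarrow> 'v set \<Rightarrow> bool"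
    and block :: "'v set \<Rightarrow> 'i set"
  assumes finite_block: "\<And>e. e \<in> E \<Longrightarrow> finite (block e)"
    and determined: "\<And>e \<omega> \<omega>'. e \<in> E \<Longrightarrow> (\<And>j. j \<in> block e \<Longrightarrow> \<omega> j = \<omega>' j) \<Longrightarrow> open_edge \<omega> e \<longleftrightarrow> open_edge \<omega>' e"
    and disjoint_blocks: "\<And>e e'. e \<in> E \<Longrightarrow> e' \<in> E \<Longrightarrow> e \<inter> e' = {} \<Longrightarrow> block e \<inter> block e' = {}"
begin

sublocale prob_space "bits r" by (rule prob_space_bits)

definition graph_of :: "('i \<Rightarrow> bool) \<Rightarrow> 'v set set" where
  "graph_of \<omega> = {e \<in> E. open_edge \<omega> e}"

definition model :: "'v set set measure" where
  "model = distr (bits r) (sigma (Pow E) (edge_event E ` E)) graph_of"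

lemma edge_event_Pow: "edge_event E ` A \<subseteq> Pow (Pow E)"
  by (auto simp: edge_event_def)

lemma open_edge_measurable:
  assumes e: "e \<in> E"
  shows "{\<omega>. open_edge \<omega> e} \<in> events"
proof -
  have "{\<omega> \<in> space (bits r). open_edge \<omega> e} \<in> events"
    unfolding bits_def
    by (rule finitely_determined_measurable[OF finite_block[OF e] subset_UNIV]) (rule determined[OF e])
  then show ?thesis by simp
qed

lemma graph_of_measurable: "graph_of \<in> measurable (bits r) (sigma (Pow E) (edge_event E ` E))"
proof (rule measurable_sigma_sets[OF sets_measure_of[OF edge_event_Pow] edge_event_Pow])
  fix a assume "a \<in> edge_event E ` E"
  then obtain e where e: "a = edge_event E e" "e \<in> E" by auto
  then have "graph_of -` a \<inter> space (bits r) = {\<omega>. open_edge \<omega> e}"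
    by (auto simp: graph_of_def edge_event_def)
  then show "graph_of -` a \<inter> space (bits r) \<in> events" using open_edge_measurable e(2) by simp
qed (auto simp: edge_event_def graph_of_def)

lemma space_model: "space model = Pow E"
  by (simp add: model_def space_measure_of[OF edge_event_Pow])

lemma sets_model: "sets model = sigma_sets (Pow E) (edge_event E ` E)"
  by (simp add: model_def sets_measure_of[OF edge_event_Pow])

lemma random_graph_model: "random_graph_model E model"
  unfolding random_graph_model_def
  using prob_space_distr[OF graph_of_measurable] space_model sets_model by (simp add: model_def)

lemma measure_model:
  "a \<in> sigma_sets (Pow E) (edge_event E ` E) \<Longrightarrow> measure model a = prob {\<omega>. graph_of \<omega> \<in> a}"
  unfolding model_def
  by (subst measure_distr[OF graph_of_measurable]) (auto simp: sets_measure_of[OF edge_event_Pow] vimage_def)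

lemma measure_edge_event: "e \<in> E \<Longrightarrow> measure model (edge_event E e) = prob {\<omega>. open_edge \<omega> e}"
  by (subst measure_model) (auto simp: edge_event_def graph_of_def Pow_def)

lemma measure_impossible:
  assumes "\<And>\<omega>. \<not> Q (graph_of \<omega>)"
  shows "measure model {S \<in> space model. Q S} = 0"
proof (cases "{S \<in> space model. Q S} \<in> sets model")
  case True
  then show ?thesis using measure_model assms by (simp add: sets_model)
next
  \<comment> \<open>A set outside the sigma-algebra has measure 0 by convention.\<close>
  case False
  then show ?thesis by (rule measure_notin_sets)
qed

text \<open>Events about the edges in \<open>A\<close> are pulled back from the bits in their
  blocks. Independence of the restrictions to disjoint \<open>K\<close> and \<open>L\<close> thereby
  carries over to the model.\<close>

lemma local_event_factors:
  assumes "A \<subseteq> E" "a \<in> sigma_sets (Pow E) (edge_event E ` A)"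
  defines "K \<equiv> \<Union>(block ` A)"
  shows "\<exists>a'\<in>sets (PiM K (\<lambda>i. measure_pmf (bernoulli_pmf (r i)))). \<forall>\<omega>. graph_of \<omega> \<in> a \<longleftrightarrow> restrict \<omega> K \<in> a'"
  using assms(2)
proof (induction rule: sigma_sets.induct)
  case (Basic a)
  then obtain e where e: "a = edge_event E e" "e \<in> A" by auto
  let ?M = "PiM K (\<lambda>i. measure_pmf (bernoulli_pmf (r i)))"
  have eE: "e \<in> E" using e assms(1) by auto
  have sub: "block e \<subseteq> K" using e by (auto simp: K_def)
  have "{x \<in> space ?M. open_edge x e} \<in> sets ?M"
    by (rule finitely_determined_measurable[OF finite_block[OF eE] sub]) (rule determined[OF eE])
  moreover have "graph_of \<omega> \<in> a \<longleftrightarrow> restrict \<omega> K \<in> {x \<in> space ?M. open_edge x e}" for \<omega>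
  proof -
    have "open_edge \<omega> e \<longleftrightarrow> open_edge (restrict \<omega> K) e"
      using sub by (intro determined[OF eE]) auto
    then show ?thesis using eE by (auto simp: graph_of_def edge_event_def e space_PiM)
  qed
  ultimately show ?case by blast
next
  case Empty
  then show ?case by (intro bexI[of _ "{}"]) auto
next
  case (Compl a)
  let ?M = "PiM K (\<lambda>i. measure_pmf (bernoulli_pmf (r i)))"
  obtain a' where a': "a' \<in> sets ?M" "\<forall>\<omega>. graph_of \<omega> \<in> a \<longleftrightarrow> restrict \<omega> K \<in> a'"
    using Compl.IH by blast
  have "graph_of \<omega> \<in> Pow E - a \<longleftrightarrow> restrict \<omega> K \<in> space ?M - a'" for \<omega>
    using a'(2) by (auto simp: graph_of_def space_PiM)
  then show ?case using sets.compl_sets[OF a'(1)] by blast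
next
  case (Union a)
  let ?M = "PiM K (\<lambda>i. measure_pmf (bernoulli_pmf (r i)))"
  have "\<forall>i. \<exists>a'. a' \<in> sets ?M \<and> (\<forall>\<omega>. graph_of \<omega> \<in> a i \<longleftrightarrow> restrict \<omega> K \<in> a')"
    using Union.IH by blast
  then obtain a' where a': "\<And>i. a' i \<in> sets ?M" "\<And>i \<omega>. graph_of \<omega> \<in> a i \<longleftrightarrow> restrict \<omega> K \<in> a' i"
    by metis
  have "graph_of \<omega> \<in> (\<Union>i. a i) \<longleftrightarrow> restrict \<omega> K \<in> (\<Union>i. a' i)" for \<omega> using a'(2) by auto
  moreover have "(\<Union>i. a' i) \<in> sets ?M" using a'(1) by (intro sets.countable_UN) auto
  ultimately show ?case by blast
qed

lemma one_independent: "one_independent E model"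
  unfolding one_independent_def
proof (intro allI impI)
  fix A B assume A: "A \<subseteq> E" and B: "B \<subseteq> E" and AB: "\<Union>A \<inter> \<Union>B = {}"
  let ?B = "\<lambda>i. measure_pmf (bernoulli_pmf (r i))"
  define K L where "K = \<Union>(block ` A)" and "L = \<Union>(block ` B)"
  have "block e \<inter> block e' = {}" if "e \<in> A" "e' \<in> B" for e e'
    using disjoint_blocks[of e e'] that A B AB by blast
  then have "K \<inter> L = {}" by (auto simp: K_def L_def)
  then have iv: "indep_var (PiM K ?B) (\<lambda>\<omega>. restrict \<omega> K) (PiM L ?B) (\<lambda>\<omega>. restrict \<omega> L)"
    using indep_var_restrict[OF indep_bits, of K L] by simp
  interpret M: prob_space model using random_graph_model by (simp add: random_graph_model_def)
  have sub: "sigma_sets (Pow E) (edge_event E ` C) \<subseteq> sigma_sets (Pow E) (edge_event E ` E)" if "C \<subseteq> E" for C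
    using that by (intro sigma_sets_mono') auto
  show "M.indep_set (sigma_sets (Pow E) (edge_event E ` A)) (sigma_sets (Pow E) (edge_event E ` B))"
  proof (rule M.indep_setI)
    show "sigma_sets (Pow E) (edge_event E ` A) \<subseteq> M.events" "sigma_sets (Pow E) (edge_event E ` B) \<subseteq> M.events"
      using sub A B by (auto simp: sets_model)
  next
    fix a b assume a: "a \<in> sigma_sets (Pow E) (edge_event E ` A)" and b: "b \<in> sigma_sets (Pow E) (edge_event E ` B)"
    show "M.prob (a \<inter> b) = M.prob a * M.prob b"
    proof -
      obtain a' where a': "a' \<in> sets (PiM K ?B)" "\<And>\<omega>. graph_of \<omega> \<in> a \<longleftrightarrow> restrict \<omega> K \<in> a'"
        using local_event_factors[OF A a] unfolding K_def by blast
      obtain b' where b': "b' \<in> sets (PiM L ?B)" "\<And>\<omega>. graph_of \<omega> \<in> b \<longleftrightarrow> restrict \<omega> L \<in> b'"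
        using local_event_factors[OF B b] unfolding L_def by blast
      have ab: "a \<in> sets model" "b \<in> sets model" using a b sub A B by (auto simp: sets_model)
      have "prob {\<omega>. restrict \<omega> K \<in> a' \<and> restrict \<omega> L \<in> b'}
          = prob {\<omega>. restrict \<omega> K \<in> a'} * prob {\<omega>. restrict \<omega> L \<in> b'}"
        using indep_varD[OF iv a'(1) b'(1)] by (simp add: vimage_def)
      then show ?thesis
        using measure_model ab sets.Int[OF ab] a'(2) b'(2) by (simp add: sets_model)
    qed
  qed
qed

end

section \<open>A model without long paths\<close>

type_synonym site = "int \<times> nat"
text \<open>\<open>Inl x\<close> decides the colour of a site, \<open>Inr e\<close> thins an
  edge.\<close>

type_synonym bit = "site + site set"

definition blue :: "(bit \<Rightarrow> bool) \<Rightarrow> site \<Rightarrow> bool" where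
  "blue \<omega> x = \<omega> (Inl x)"

text \<open>Layers divisible by 3 are fully joined. Between layers \<open>3 k\<close> and \<open>3 k + 3\<close> the blue sites
  belong to the left block. A site of layer \<open>3 k + 1\<close> that is not blue has no neighbour except the
  one in layer \<open>3 k + 2\<close>, so this rung may always be present.\<close>

definition joined :: "(bit \<Rightarrow> bool) \<Rightarrow> site \<Rightarrow> site \<Rightarrow> bool" where
  "joined \<omega> x y \<longleftrightarrow>
     (fst y = fst x \<and> (fst x mod 3 = 0 \<or> (fst x mod 3 = 1 \<and> blue \<omega> x \<and> blue \<omega> y)
        \<or> (fst x mod 3 = 2 \<and> (blue \<omega> x \<longleftrightarrow> blue \<omega> y)))) \<or>
     (fst y = fst x + 1 \<and> ((fst x mod 3 = 0 \<and> blue \<omega> y) \<or> (fst x mod 3 = 1 \<and> (blue \<omega> x \<longrightarrow> blue \<omega> y))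
        \<or> (fst x mod 3 = 2 \<and> \<not> blue \<omega> x)))"

text \<open>\<open>joined\<close> runs from the lower to the upper layer whereas an edge is
  unordered, hence the choice of an order of its ends.\<close>

definition open_edge :: "(bit \<Rightarrow> bool) \<Rightarrow> site set \<Rightarrow> bool" where
  "open_edge \<omega> e \<longleftrightarrow> \<omega> (Inr e) \<and> (\<exists>x y. e = {x, y} \<and> joined \<omega> x y)"

definition edge_block :: "site set \<Rightarrow> bit set" where
  "edge_block e = insert (Inr e) (Inl ` e)"

text \<open>The probability that the endpoint colours admit an edge of the product graph. The
  minimum is the lower layer; a single layer index marks an edge inside a layer.\<close>

definition join_prob :: "site set \<Rightarrow> real" where
  "join_prob e = (let k = Min (fst ` e) mod 3 in
     if card (fst ` e) = 1 then (if k = 0 then 1 else p0)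
     else (if k = 0 then sqrt 3 - 1 else if k = 1 then p0 else (3 - sqrt 3) / 2))"

text \<open>The bit of an edge thins it to the prescribed density.\<close>

definition bit_prob :: "real \<Rightarrow> bit \<Rightarrow> real" where
  "bit_prob p b = (case b of Inl x \<Rightarrow> (if fst x mod 3 = 1 then sqrt 3 - 1 else (sqrt 3 - 1) / 2)
     | Inr e \<Rightarrow> p / join_prob e)"

lemma join_prob_ge: "p0 \<le> join_prob e"
  using sqrt3_bounds by (auto simp: join_prob_def Let_def)

lemma bit_prob_bounds:
  assumes "0 \<le> p" "p \<le> p0"
  shows "0 \<le> bit_prob p b" "bit_prob p b \<le> 1"
  using assms sqrt3_bounds join_prob_ge[of "projr b"]
  by (auto simp: bit_prob_def divide_le_eq split: sum.split)

lemma open_edge_doubleton: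
  "open_edge \<omega> {x, y} \<longleftrightarrow> \<omega> (Inr {x, y}) \<and> (joined \<omega> x y \<or> joined \<omega> y x)"
  unfolding open_edge_def doubleton_eq_iff by blast

lemma open_layer_edge:
  "u \<noteq> v \<Longrightarrow> open_edge \<omega> {(i, u), (i, v)} \<longleftrightarrow> \<omega> (Inr {(i, u), (i, v)}) \<and> joined \<omega> (i, u) (i, v)"
  by (subst open_edge_doubleton) (auto simp: joined_def)

lemma open_rung_edge:
  "open_edge \<omega> {(i, u), (i + 1, u)} \<longleftrightarrow> \<omega> (Inr {(i, u), (i + 1, u)}) \<and> joined \<omega> (i, u) (i + 1, u)"
  by (subst open_edge_doubleton) (auto simp: joined_def)

lemma join_prob_layer: "join_prob {(i, u), (i, v)} = (if i mod 3 = 0 then 1 else p0)"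
  by (simp add: join_prob_def)

lemma join_prob_rung:
  "join_prob {(i, u), (i + 1, u)} = (if i mod 3 = 0 then sqrt 3 - 1 else if i mod 3 = 1 then p0 else (3 - sqrt 3) / 2)"
  by (simp add: join_prob_def)

lemma block_factor_Z: "block_factor (Z_times_edges G n) open_edge edge_block"
proof
  fix e assume e: "e \<in> Z_times_edges G n"
  show "finite (edge_block e)" using e by (auto simp: edge_block_def Z_times_edges_def)
  fix \<omega> \<omega>' :: "bit \<Rightarrow> bool" assume eq: "\<And>j. j \<in> edge_block e \<Longrightarrow> \<omega> j = \<omega>' j"
  have "blue \<omega> x = blue \<omega>' x" if "x \<in> e" for x
    using that eq[of "Inl x"] by (auto simp: blue_def edge_block_def)
  then have "joined \<omega> x y \<longleftrightarrow> joined \<omega>' x y" if "e = {x, y}" for x y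
    using that by (simp add: joined_def)
  moreover have "\<omega> (Inr e) = \<omega>' (Inr e)" by (rule eq) (simp add: edge_block_def)
  ultimately show "open_edge \<omega> e \<longleftrightarrow> open_edge \<omega>' e" unfolding open_edge_def by blast
next
  fix e e' assume e: "e \<in> Z_times_edges G n" and disj: "e \<inter> e' = {}"
  have "e \<noteq> {}" using e by (auto simp: Z_times_edges_def)
  then have "e \<noteq> e'" using disj by blast
  then show "edge_block e \<inter> edge_block e' = {}" using disj by (auto simp: edge_block_def)
qed

section \<open>Edge densities of the colouring model\<close>

context
  fixes r :: "bit \<Rightarrow> real"
  assumes r: "\<And>i. 0 \<le> r i" "\<And>i. r i \<le> 1"
begin

lemma measure_bits_pair:
  assumes "j \<noteq> k"
  shows "measure (bits r) {\<omega>. \<omega> j = a \<and> \<omega> k = b} = (if a then r j else 1 - r j) * (if b then r k else 1 - r k)"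
  using measure_bits_cylinder[of "{j, k}" r "(\<lambda>_. a)(k := b)"] r assms by simp

lemma measure_bits_single: "measure (bits r) {\<omega>. \<omega> j = a} = (if a then r j else 1 - r j)"
  using measure_bits_cylinder[of "{j}" r "\<lambda>_. a"] r by simp

lemma measure_bits_triple:
  assumes "j \<noteq> k" "j \<noteq> l" "k \<noteq> l"
  shows "measure (bits r) {\<omega>. \<omega> j = a \<and> \<omega> k = b \<and> \<omega> l = c}
    = (if a then r j else 1 - r j) * (if b then r k else 1 - r k) * (if c then r l else 1 - r l)"
  using measure_bits_cylinder[of "{j, k, l}" r "(\<lambda>_. a)(k := b, l := c)"] r assms by simp

lemma bits_event_measurable:
  "finite J \<Longrightarrow> {\<omega>. \<forall>j\<in>J. \<omega> j = t j} \<in> sets (bits r)"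
  using finitely_determined_measurable[of J UNIV "\<lambda>\<omega>. \<forall>j\<in>J. \<omega> j = t j" r]
  unfolding bits_def[symmetric] by simp

lemma measure_bits_iff:
  assumes "j \<noteq> k" "j \<noteq> l" "k \<noteq> l"
  shows "measure (bits r) {\<omega>. \<omega> j \<and> (\<omega> k \<longleftrightarrow> \<omega> l)} = r j * (r k * r l + (1 - r k) * (1 - r l))"
proof -
  interpret prob_space "bits r" by (rule prob_space_bits)
  define A B where "A = {\<omega> :: bit \<Rightarrow> bool. \<omega> j = True \<and> \<omega> k = True \<and> \<omega> l = True}"
    and "B = {\<omega> :: bit \<Rightarrow> bool. \<omega> j = True \<and> \<omega> k = False \<and> \<omega> l = False}"
  have "A \<in> events"
    using bits_event_measurable[of "{j, k, l}" "\<lambda>_. True"] by (simp add: A_def)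
  moreover have "B \<in> events"
    using bits_event_measurable[of "{j, k, l}" "(\<lambda>_. True)(k := False, l := False)"] assms
    by (simp add: B_def)
  moreover have "A \<inter> B = {}" by (auto simp: A_def B_def)
  ultimately have "prob (A \<union> B) = prob A + prob B" by (rule finite_measure_Union)
  moreover have "A \<union> B = {\<omega>. \<omega> j \<and> (\<omega> k \<longleftrightarrow> \<omega> l)}" by (auto simp: A_def B_def)
  moreover have "prob A = r j * r k * r l" "prob B = r j * (1 - r k) * (1 - r l)"
    unfolding A_def B_def measure_bits_triple[OF assms] by simp_all
  ultimately show ?thesis by (simp add: distrib_left mult.assoc)
qed

lemma measure_bits_imp:
  assumes "j \<noteq> k" "j \<noteq> l" "k \<noteq> l"
  shows "measure (bits r) {\<omega>. \<omega> j \<and> (\<omega> k \<longrightarrow> \<omega> l)} = r j * ((1 - r k) + r k * r l)"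
proof -
  interpret prob_space "bits r" by (rule prob_space_bits)
  define A B where "A = {\<omega> :: bit \<Rightarrow> bool. \<omega> j = True \<and> \<omega> k = False}"
    and "B = {\<omega> :: bit \<Rightarrow> bool. \<omega> j = True \<and> \<omega> k = True \<and> \<omega> l = True}"
  have "A \<in> events"
    using bits_event_measurable[of "{j, k}" "(\<lambda>_. True)(k := False)"] assms by (simp add: A_def)
  moreover have "B \<in> events"
    using bits_event_measurable[of "{j, k, l}" "\<lambda>_. True"] by (simp add: B_def)
  moreover have "A \<inter> B = {}" by (auto simp: A_def B_def)
  ultimately have "prob (A \<union> B) = prob A + prob B" by (rule finite_measure_Union)
  moreover have "A \<union> B = {\<omega>. \<omega> j \<and> (\<omega> k \<longrightarrow> \<omega> l)}" by (auto simp: A_def B_def)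
  moreover have "prob A = r j * (1 - r k)" "prob B = r j * r k * r l"
    unfolding A_def B_def measure_bits_pair[OF assms(1)] measure_bits_triple[OF assms] by simp_all
  ultimately show ?thesis by (simp add: distrib_left mult.assoc)
qed

end

lemma prob_open_edge:
  assumes p: "0 \<le> p" "p \<le> p0" and e: "e \<in> Z_times_edges G n" and G: "\<And>u v. G u v \<Longrightarrow> u \<noteq> v"
  shows "measure (bits (bit_prob p)) {\<omega>. open_edge \<omega> e} = p"
proof -
  define r where "r = bit_prob p"
  have r: "\<And>b. 0 \<le> r b" "\<And>b. r b \<le> 1" unfolding r_def by (rule bit_prob_bounds[OF p])+
  have site: "r (Inl x) = (if fst x mod 3 = 1 then sqrt 3 - 1 else (sqrt 3 - 1) / 2)" for x
    by (simp add: r_def bit_prob_def)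
  have jp: "join_prob e \<noteq> 0" using join_prob_ge[of e] sqrt3_bounds by auto
  \<comment> \<open>The thinning bit is independent of the colours, so its parameter
    \<open>p / join_prob e\<close> cancels the probability \<open>c\<close> of the colour
    condition.\<close>
  have factor: "measure (bits r) {\<omega>. open_edge \<omega> e} = p"
    if "{\<omega>. open_edge \<omega> e} = A" "measure (bits r) A = r (Inr e) * c" "c = join_prob e" for A c
    using that jp by (simp add: r_def bit_prob_def)
  \<comment> \<open>The density is \<open>p0\<close> for two blue sites in a layer
    \<open>3 k + 1\<close>, for equal colours in a layer \<open>3 k + 2\<close>, and for the
    implication on the rung between them. The colour probabilities are tuned to make these three
    agree.\<close>
  have n1: "(sqrt 3 - 1) * (sqrt 3 - 1) = p0"
    and n2: "(sqrt 3 - 1) / 2 * ((sqrt 3 - 1) / 2) + (1 - (sqrt 3 - 1) / 2) * (1 - (sqrt 3 - 1) / 2) = p0"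
    and n3: "(1 - (sqrt 3 - 1)) + (sqrt 3 - 1) * ((sqrt 3 - 1) / 2) = p0"
    and n4: "1 - (sqrt 3 - 1) / 2 = (3 - sqrt 3) / 2"
    by (simp_all add: field_simps)
  consider (layer) i u v where "e = {(i, u), (i, v)}" "G u v" | (rung) i u where "e = {(i, u), (i + 1, u)}"
    using e unfolding Z_times_edges_def by blast
  then have "measure (bits r) {\<omega>. open_edge \<omega> e} = p"
  proof cases
    case (layer i u v)
    have uv: "u \<noteq> v" using layer(2) by (rule G)
    have "i mod 3 \<in> {0, 1, 2}" by auto
    then consider "i mod 3 = 0" | "i mod 3 = 1" | "i mod 3 = 2" by auto
    then show ?thesis
    proof cases
      case 1
      show ?thesis
      proof (rule factor)
        show "{\<omega>. open_edge \<omega> e} = {\<omega>. \<omega> (Inr e) = True}"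
          unfolding layer(1) open_layer_edge[OF uv] using 1 by (simp add: joined_def)
      qed (simp_all only: measure_bits_single[OF r], simp_all add: 1 layer(1) join_prob_layer)
    next
      case 2
      show ?thesis
      proof (rule factor)
        show "{\<omega>. open_edge \<omega> e} = {\<omega>. \<omega> (Inr e) = True \<and> \<omega> (Inl (i, u)) = True \<and> \<omega> (Inl (i, v)) = True}"
          unfolding layer(1) open_layer_edge[OF uv] using 2 by (simp add: joined_def blue_def)
        show "measure (bits r) {\<omega>. \<omega> (Inr e) = True \<and> \<omega> (Inl (i, u)) = True \<and> \<omega> (Inl (i, v)) = True}
            = r (Inr e) * (r (Inl (i, u)) * r (Inl (i, v)))"
          by (subst measure_bits_triple[OF r]) (use uv in auto)
        show "r (Inl (i, u)) * r (Inl (i, v)) = join_prob e"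
          unfolding site layer(1) join_prob_layer using 2 n1 by simp
      qed
    next
      case 3
      show ?thesis
      proof (rule factor)
        show "{\<omega>. open_edge \<omega> e} = {\<omega>. \<omega> (Inr e) \<and> (\<omega> (Inl (i, u)) \<longleftrightarrow> \<omega> (Inl (i, v)))}"
          unfolding layer(1) open_layer_edge[OF uv] using 3 by (simp add: joined_def blue_def)
        show "measure (bits r) {\<omega>. \<omega> (Inr e) \<and> (\<omega> (Inl (i, u)) \<longleftrightarrow> \<omega> (Inl (i, v)))}
            = r (Inr e) * (r (Inl (i, u)) * r (Inl (i, v)) + (1 - r (Inl (i, u))) * (1 - r (Inl (i, v))))"
          by (rule measure_bits_iff[OF r]) (use uv in auto)
        show "r (Inl (i, u)) * r (Inl (i, v)) + (1 - r (Inl (i, u))) * (1 - r (Inl (i, v))) = join_prob e"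
          unfolding site layer(1) join_prob_layer using 3 n2 by simp
      qed
    qed
  next
    case (rung i u)
    have "i mod 3 = 0 \<and> (i + 1) mod 3 = 1 \<or> i mod 3 = 1 \<and> (i + 1) mod 3 = 2 \<or> i mod 3 = 2 \<and> (i + 1) mod 3 = 0"
      by presburger
    then consider "i mod 3 = 0" "(i + 1) mod 3 = 1" | "i mod 3 = 1" "(i + 1) mod 3 = 2"
      | "i mod 3 = 2" "(i + 1) mod 3 = 0"
      by blast
    then show ?thesis
    proof cases
      case 1
      show ?thesis
      proof (rule factor)
        show "{\<omega>. open_edge \<omega> e} = {\<omega>. \<omega> (Inr e) = True \<and> \<omega> (Inl (i + 1, u)) = True}"
          unfolding rung open_rung_edge using 1 by (simp add: joined_def blue_def)
        show "measure (bits r) {\<omega>. \<omega> (Inr e) = True \<and> \<omega> (Inl (i + 1, u)) = True} = r (Inr e) * r (Inl (i + 1, u))"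
          by (subst measure_bits_pair[OF r]) auto
        show "r (Inl (i + 1, u)) = join_prob e"
          unfolding site rung join_prob_rung using 1 by simp
      qed
    next
      case 2
      show ?thesis
      proof (rule factor)
        show "{\<omega>. open_edge \<omega> e} = {\<omega>. \<omega> (Inr e) \<and> (\<omega> (Inl (i, u)) \<longrightarrow> \<omega> (Inl (i + 1, u)))}"
          unfolding rung open_rung_edge using 2 by (simp add: joined_def blue_def)
        show "measure (bits r) {\<omega>. \<omega> (Inr e) \<and> (\<omega> (Inl (i, u)) \<longrightarrow> \<omega> (Inl (i + 1, u)))}
            = r (Inr e) * ((1 - r (Inl (i, u))) + r (Inl (i, u)) * r (Inl (i + 1, u)))"
          by (rule measure_bits_imp[OF r]) auto
        show "(1 - r (Inl (i, u))) + r (Inl (i, u)) * r (Inl (i + 1, u)) = join_prob e"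
          unfolding site rung join_prob_rung using 2 n3 by simp
      qed
    next
      case 3
      show ?thesis
      proof (rule factor)
        show "{\<omega>. open_edge \<omega> e} = {\<omega>. \<omega> (Inr e) = True \<and> \<omega> (Inl (i, u)) = False}"
          unfolding rung open_rung_edge using 3 by (auto simp: joined_def blue_def)
        show "measure (bits r) {\<omega>. \<omega> (Inr e) = True \<and> \<omega> (Inl (i, u)) = False} = r (Inr e) * (1 - r (Inl (i, u)))"
          by (subst measure_bits_pair[OF r]) auto
        show "1 - r (Inl (i, u)) = join_prob e"
          unfolding site rung join_prob_rung using 3 n4 by simp
      qed
    qed
  qed
  then show ?thesis by (simp add: r_def)
qed

text \<open>Open edges preserve this colour, and each colour occurs on at most five consecutive layers.\<close>

definition colour :: "(bit \<Rightarrow> bool) \<Rightarrow> site \<Rightarrow> int" where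
  "colour \<omega> x = fst x div 3 +
     (if fst x mod 3 = 2 \<and> \<not> blue \<omega> x \<or> fst x mod 3 = 1 \<and> \<not> blue \<omega> x \<and> \<not> blue \<omega> (fst x + 1, snd x) then 1 else 0)"

lemma colour_layers: "3 * colour \<omega> x - 2 \<le> fst x \<and> fst x \<le> 3 * colour \<omega> x + 2"
proof -
  define d m where "d = fst x div 3" and "m = fst x mod 3"
  have "fst x = 3 * d + m" "0 \<le> m" "m < 3" by (simp_all add: d_def m_def)
  then show ?thesis
    unfolding colour_def d_def[symmetric] m_def[symmetric] by (auto split: if_splits)
qed

text \<open>The delicate case is a site of layer \<open>3 k + 1\<close> that is not blue: it takes
  the colour of the site above it in the same row, its only possible neighbour.\<close>

lemma colour_joined:
  assumes "joined \<omega> x y" "fst x = fst y \<or> snd x = snd y"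
  shows "colour \<omega> x = colour \<omega> y"
proof -
  obtain i u j v where x: "x = (i, u)" and y: "y = (j, v)" by (metis surj_pair)
  have "i mod 3 = 0 \<and> (i + 1) mod 3 = 1 \<and> (i + 1) div 3 = i div 3 \<or>
      i mod 3 = 1 \<and> (i + 1) mod 3 = 2 \<and> (i + 1) div 3 = i div 3 \<or>
      i mod 3 = 2 \<and> (i + 1) mod 3 = 0 \<and> (i + 1) div 3 = i div 3 + 1"
    by presburger
  then consider "i mod 3 = 0" "(i + 1) mod 3 = 1" "(i + 1) div 3 = i div 3"
    | "i mod 3 = 1" "(i + 1) mod 3 = 2" "(i + 1) div 3 = i div 3"
    | "i mod 3 = 2" "(i + 1) mod 3 = 0" "(i + 1) div 3 = i div 3 + 1"
    by blast
  then show ?thesis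
    using assms unfolding x y by cases (simp_all add: joined_def colour_def, auto)
qed

lemma colour_open_edge:
  assumes e: "{x, y} \<in> Z_times_edges G n" and o: "open_edge \<omega> {x, y}"
  shows "colour \<omega> x = colour \<omega> y"
proof -
  obtain x' y' where xy: "{x, y} = {x', y'}" "joined \<omega> x' y'" using o by (auto simp: open_edge_def)
  have "fst x = fst y \<or> snd x = snd y" using e by (auto simp: Z_times_edges_def doubleton_eq_iff)
  then show ?thesis using colour_joined[OF xy(2)] xy(1) by (auto simp: doubleton_eq_iff)
qed

text \<open>A path keeps its colour and so stays within five layers, which hold \<open>5 * n\<close>
  sites, one fewer than a path of length \<open>5 * n\<close> visits.\<close>

lemma no_long_path:
  assumes n: "0 < n"
  shows "\<not> has_path {e \<in> Z_times_edges G n. open_edge \<omega> e} (5 * n)"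
proof
  assume "has_path {e \<in> Z_times_edges G n. open_edge \<omega> e} (5 * n)"
  then obtain vs where vs: "length vs = Suc (5 * n)" "distinct vs"
    and edge: "\<And>i. i < 5 * n \<Longrightarrow> {vs ! i, vs ! Suc i} \<in> Z_times_edges G n \<and> open_edge \<omega> {vs ! i, vs ! Suc i}"
    by (auto simp: has_path_def)
  have colour: "colour \<omega> (vs ! i) = colour \<omega> (vs ! 0)" if "i \<le> 5 * n" for i
    using that
  proof (induction i)
    case (Suc i)
    then have "{vs ! i, vs ! Suc i} \<in> Z_times_edges G n" "open_edge \<omega> {vs ! i, vs ! Suc i}"
      using edge[of i] by simp_all
    then have "colour \<omega> (vs ! i) = colour \<omega> (vs ! Suc i)" by (rule colour_open_edge)
    then show ?case using Suc by simp
  qed simp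
  have row: "snd (vs ! i) < n" if "i \<le> 5 * n" for i
  proof -
    have ends: "snd x < n \<and> snd y < n" if "{x, y} \<in> Z_times_edges G n" for x y
      using that by (auto simp: Z_times_edges_def doubleton_eq_iff)
    have both: "snd (vs ! i) < n \<and> snd (vs ! Suc i) < n" if "i < 5 * n" for i
      using edge[OF that] by (intro ends) simp
    show ?thesis
    proof (cases "i < 5 * n")
      case False
      then have "i = Suc (5 * n - 1)" using that n by simp
      then show ?thesis using both[of "5 * n - 1"] n by simp
    qed (use both in simp)
  qed
  define c where "c = colour \<omega> (vs ! 0)"
  have "set vs \<subseteq> {3 * c - 2..3 * c + 2} \<times> {..<n}"
  proof
    fix x assume "x \<in> set vs"
    then obtain i where i: "i \<le> 5 * n" "x = vs ! i" using vs(1) by (auto simp: in_set_conv_nth less_Suc_eq_le)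
    then have "colour \<omega> x = c" "snd x < n" using colour[OF i(1)] row[OF i(1)] by (simp_all add: c_def)
    then show "x \<in> {3 * c - 2..3 * c + 2} \<times> {..<n}"
      using colour_layers[of \<omega> x] by (cases x) auto
  qed
  then have "card (set vs) \<le> card ({3 * c - 2..3 * c + 2} \<times> {..<n})" by (intro card_mono) auto
  also have "\<dots> = 5 * n" by (simp add: card_cartesian_product)
  finally show False using vs by (simp add: distinct_card)
qed

lemma short_paths_model:
  assumes p: "0 \<le> p" "p \<le> p0" and G: "\<And>u v. G u v \<Longrightarrow> u \<noteq> v" and n: "0 < n"
  shows "\<exists>\<mu>. M1p (Z_times_edges G n) p \<mu> \<and> measure \<mu> {S \<in> space \<mu>. has_path S (5 * n)} = 0"
proof -
  interpret block_factor "Z_times_edges G n" "bit_prob p" open_edge edge_block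
    by (rule block_factor_Z)
  have "measure model (edge_event (Z_times_edges G n) e) = p" if "e \<in> Z_times_edges G n" for e
    unfolding measure_edge_event[OF that] using p that G by (rule prob_open_edge)
  then have "M1p (Z_times_edges G n) p model"
    using random_graph_model one_independent by (simp add: M1p_def)
  moreover have "measure model {S \<in> space model. has_path S (5 * n)} = 0"
  proof (rule measure_impossible)
    show "\<not> has_path (graph_of \<omega>) (5 * n)" for \<omega>
      unfolding graph_of_def using n by (rule no_long_path)
  qed
  ultimately show ?thesis by blast
qed

section \<open>The limit\<close>

definition percolating :: "'v set set \<Rightarrow> real set" where
  "percolating E = {p \<in> {0..1}. \<forall>\<mu>. M1p E p \<mu> \<longrightarrow> (\<forall>l. measure \<mu> {S \<in> space \<mu>. has_path S l} > 0)}"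

lemma p1LP_percolating: "p1LP E = Inf (percolating E)"
  by (simp add: p1LP_def percolating_def)

lemma percolating_ge:
  assumes "p \<in> percolating (Z_times_edges G n)" and G: "\<And>u v. G u v \<Longrightarrow> u \<noteq> v" and n: "0 < n"
  shows "p0 \<le> p"
proof (rule ccontr)
  assume "\<not> p0 \<le> p"
  then have "0 \<le> p" "p \<le> p0" using assms(1) by (auto simp: percolating_def)
  then obtain \<mu> where "M1p (Z_times_edges G n) p \<mu>" "measure \<mu> {S \<in> space \<mu>. has_path S (5 * n)} = 0"
    using short_paths_model[of p G n] G n by blast
  moreover have "0 < measure \<mu> {S \<in> space \<mu>. has_path S (5 * n)}"
    using assms(1) calculation(1) by (simp add: percolating_def)
  ultimately show False by simp
qed

text \<open>The member \<open>p\<close> also witnesses that the set is nonempty, on which the lower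
  bound for its \<open>Inf\<close> relies.\<close>

lemma p1LP_bounds:
  assumes p: "p \<in> percolating (Z_times_edges G n)" and G: "\<And>u v. G u v \<Longrightarrow> u \<noteq> v" and n: "0 < n"
  shows "p0 \<le> p1LP (Z_times_edges G n)" "p1LP (Z_times_edges G n) \<le> p"
proof -
  have "p0 \<le> x" if "x \<in> percolating (Z_times_edges G n)" for x
    using that G n by (rule percolating_ge)
  then show "p0 \<le> p1LP (Z_times_edges G n)"
    unfolding p1LP_percolating using p by (intro cInf_greatest) auto
  have "bdd_below (percolating (Z_times_edges G n))"
    by (rule bdd_belowI[of _ 0]) (auto simp: percolating_def)
  then show "p1LP (Z_times_edges G n) \<le> p"
    unfolding p1LP_percolating using p by (intro cInf_lower)
qed

lemma weakly_pseudorandom_eventually: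
  assumes pr: "weakly_pseudorandom q G" and c: "0 < c"
  shows "\<forall>\<^sub>F n in sequentially. \<forall>U\<subseteq>{..<n}.
    \<bar>real (e_ind (G n) U) - q n * real (card U) ^ 2 / 2\<bar> \<le> c * \<bar>q n * real n ^ 2\<bar>"
proof -
  define F where "F n U = \<bar>real (e_ind (G n) U) - q n * real (card U) ^ 2 / 2\<bar>" for n U
  have "\<forall>\<^sub>F n in sequentially. norm (Max (F n ` Pow {0..<n})) \<le> c * norm (q n * real n ^ 2)"
    using pr c unfolding weakly_pseudorandom_def F_def by (rule landau_o.smallD)
  then show ?thesis
  proof (rule eventually_mono)
    fix n assume le: "norm (Max (F n ` Pow {0..<n})) \<le> c * norm (q n * real n ^ 2)"
    show "\<forall>U\<subseteq>{..<n}. \<bar>real (e_ind (G n) U) - q n * real (card U) ^ 2 / 2\<bar> \<le> c * \<bar>q n * real n ^ 2\<bar>"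
    proof (intro allI impI)
      fix U assume "U \<subseteq> {..<n}"
      then have "F n U \<le> Max (F n ` Pow {0..<n})"
        by (intro Max_ge) (auto simp: atLeast0LessThan)
      then show "\<bar>real (e_ind (G n) U) - q n * real (card U) ^ 2 / 2\<bar> \<le> c * \<bar>q n * real n ^ 2\<bar>"
        using le by (simp add: F_def)
    qed
  qed
qed

text \<open>The logarithm rules out \<open>q n = 0\<close>. If \<open>q n\<close> were negative, the
  edge count of the whole graph would miss its approximation by at least
  \<open>\<bar>q n\<bar> * n ^ 2 / 2\<close>, as edge counts are nonnegative.\<close>

lemma density_positive:
  assumes nq: "(\<lambda>n. ln (real n)) \<in> o(\<lambda>n. real n * q n)" and pr: "weakly_pseudorandom q G"
  shows "\<forall>\<^sub>F n in sequentially. 0 < q n"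
proof -
  have "\<forall>\<^sub>F n in sequentially. norm (ln (real n)) \<le> 1 * norm (real n * q n)"
    using nq by (rule landau_o.smallD) simp
  moreover have "\<forall>\<^sub>F n in sequentially. \<forall>U\<subseteq>{..<n}.
      \<bar>real (e_ind (G n) U) - q n * real (card U) ^ 2 / 2\<bar> \<le> 1 / 4 * \<bar>q n * real n ^ 2\<bar>"
    by (rule weakly_pseudorandom_eventually[OF pr]) simp
  ultimately show ?thesis
    using eventually_ge_at_top[of 2]
  proof eventually_elim
    case (elim n)
    have "0 < ln (real n)" using elim(3) by (intro ln_gt_zero) auto
    then have "q n \<noteq> 0" using elim(1) by auto
    moreover have "\<not> q n < 0"
    proof
      assume q: "q n < 0"
      have "\<bar>real (e_ind (G n) {..<n}) - q n * real n ^ 2 / 2\<bar> \<le> 1 / 4 * \<bar>q n * real n ^ 2\<bar>"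
        using elim(2) by (metis card_lessThan subset_refl)
      moreover have "q n * real n ^ 2 < 0" using q elim(3) by (simp add: mult_neg_pos)
      ultimately show False by simp
    qed
    ultimately show "0 < q n" by linarith
  qed
qed

lemma degree_at_top:
  assumes nq: "(\<lambda>n. ln (real n)) \<in> o(\<lambda>n. real n * q n)" and pr: "weakly_pseudorandom q G"
  shows "filterlim (\<lambda>n. real n * q n) at_top sequentially"
proof (rule filterlim_at_top_mono)
  show "filterlim (\<lambda>n. ln (real n)) at_top sequentially"
    by (rule filterlim_compose[OF ln_at_top filterlim_real_sequentially])
  have "\<forall>\<^sub>F n in sequentially. norm (ln (real n)) \<le> 1 * norm (real n * q n)"
    using nq by (rule landau_o.smallD) simp
  then show "\<forall>\<^sub>F n in sequentially. ln (real n) \<le> real n * q n"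
    using density_positive[OF nq pr]
  proof eventually_elim
    case (elim n)
    then show ?case by (simp add: abs_mult)
  qed
qed

lemma eventually_percolating:
  assumes nq: "(\<lambda>n. ln (real n)) \<in> o(\<lambda>n. real n * q n)"
    and graph: "\<And>n u v. G n u v \<Longrightarrow> u < n \<and> v < n \<and> u \<noteq> v \<and> G n v u"
    and pr: "weakly_pseudorandom q G" and p: "p0 < p" "p \<le> 1"
  shows "\<forall>\<^sub>F n in sequentially. p \<in> percolating (Z_times_edges (G n) n)"
proof -
  \<comment> \<open>The order of choice is \<open>\<epsilon>\<close>, \<open>\<eta>\<close>,
    \<open>c\<close>, \<open>b\<close>, \<open>\<delta>\<close> and finally \<open>n\<close>. The
    value \<open>\<epsilon> / 30\<close> gives \<open>10 * \<eta> + \<delta> \<le> \<epsilon> / 3 +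
    \<epsilon> / 2 < \<epsilon>\<close>. The permitted slack is \<open>c\<close>; one half is spent
    by \<open>b\<close> on small components, the other by \<open>\<delta>\<close> on edge
    counts.\<close>
  define \<epsilon> \<eta> where "\<epsilon> = p - p0" and "\<eta> = \<epsilon> / 30"
  have \<epsilon>: "0 < \<epsilon>" "\<epsilon> < 1" using p sqrt3_bounds by (auto simp: \<epsilon>_def)
  have \<eta>: "0 < \<eta>" "\<eta> < 1" using \<epsilon> by (auto simp: \<eta>_def)
  define c where "c = \<epsilon> * \<eta> ^ 2"
  have c: "0 < c" using \<epsilon> \<eta> by (simp add: c_def)
  obtain b0 :: nat where b0: "4 / c < real b0" using reals_Archimedean2 by blast
  define b where "b = Suc b0"
  have b: "0 < b" "2 / real b \<le> c / 2" using b0 c by (auto simp: b_def field_simps)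
  define \<delta> where "\<delta> = min (\<epsilon> / 2) (c / (2 * (22 * real b + 45)))"
  have \<delta>: "0 < \<delta>" "\<delta> \<le> \<epsilon> / 2" unfolding \<delta>_def using \<epsilon> c by (simp, intro min.cobounded1)
  have "\<delta> \<le> c / (2 * (22 * real b + 45))" by (simp add: \<delta>_def)
  then have "(22 * real b + 45) * \<delta> \<le> c / 2" by (simp add: field_simps)
  then have slack: "2 / real b + (22 * real b + 45) * \<delta> \<le> c" using b(2) by linarith
  have half: "\<epsilon> < p - 1 / 2" using sqrt3_bounds by (simp add: \<epsilon>_def)
  have "\<eta> ^ 2 < \<eta>" using \<eta> by (simp add: power2_eq_square)
  then have "c < \<epsilon> * \<eta>" using \<epsilon> by (simp add: c_def)
  moreover have "\<epsilon> * \<eta> \<le> (p - 1 / 2) * \<eta>" "(p - 1 / 2) * \<eta> \<le> (p - 1 / 2) * 1"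
    using half \<eta> \<epsilon> by (intro mult_right_mono mult_left_mono; simp)+
  ultimately have c': "c < (p - 1 / 2) * \<eta>" "c < p - 1 / 2" by auto
  have deg: "filterlim (\<lambda>n. real n * q n) at_top sequentially" using nq pr by (rule degree_at_top)
  have "(\<lambda>n. 48 * (2 ^ b + 2) / \<delta> ^ 2 * (1 / (real n * q n)) + 1 / \<delta> ^ 2 * (1 / real n))
      \<longlonglongrightarrow> 48 * (2 ^ b + 2) / \<delta> ^ 2 * 0 + 1 / \<delta> ^ 2 * 0"
    using tendsto_inverse_0_at_top[OF deg] tendsto_inverse_0_at_top[OF filterlim_real_sequentially]
    by (intro tendsto_add tendsto_mult tendsto_const) (simp_all only: inverse_eq_divide)
  then have "\<forall>\<^sub>F n in sequentially.
      48 * (2 ^ b + 2) / \<delta> ^ 2 * (1 / (real n * q n)) + 1 / \<delta> ^ 2 * (1 / real n) < 1 / 4"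
    by (rule order_tendstoD) simp
  moreover have "\<forall>\<^sub>F n in sequentially. \<forall>U\<subseteq>{..<n}.
      \<bar>real (e_ind (G n) U) - q n * real (card U) ^ 2 / 2\<bar> \<le> \<delta> * \<bar>q n * real n ^ 2\<bar>"
    using pr \<delta>(1) by (rule weakly_pseudorandom_eventually)
  ultimately show ?thesis
    using density_positive[OF nq pr] eventually_gt_at_top[of 0]
  proof eventually_elim
    case (elim n)
    have "0 < measure \<mu> {S \<in> space \<mu>. has_path S l}" if "M1p (Z_times_edges (G n) n) p \<mu>" for \<mu> l
    proof -
      interpret quasirandom_model "G n" n "q n" \<delta> p \<mu>
      proof
        show "\<bar>real (e_ind (G n) U) - q n * real (card U) ^ 2 / 2\<bar> \<le> \<delta> * (q n * real n ^ 2)"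
          if "U \<subseteq> {..<n}" for U
          using elim(2,3) that by (simp add: abs_mult)
        show "u < n \<and> v < n \<and> u \<noteq> v \<and> G n v u" if "G n u v" for u v
          using that by (rule graph)
      qed (use elim \<delta> \<epsilon> that in auto)
      show ?thesis
      proof (rule long_paths[of b \<eta>])
        show "10 * \<eta> + \<delta> < p - p0" using \<delta>(2) \<epsilon> unfolding \<epsilon>_def[symmetric] \<eta>_def by simp
        show "48 * (2 ^ b + 2) / (\<delta> ^ 2 * (real n * q n)) + 1 / (\<delta> ^ 2 * real n) \<le> 1 / 4"
          using elim(1) by simp
      qed (use b \<eta> p slack c' in \<open>auto simp: slack_def c_def \<epsilon>_def\<close>)
    qed
    then show "p \<in> percolating (Z_times_edges (G n) n)"
      using p sqrt3_bounds by (simp add: percolating_def)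
  qed
qed

theorem theorem12:
  fixes q :: "nat \<Rightarrow> real" and G :: "nat \<Rightarrow> nat \<Rightarrow> nat \<Rightarrow> bool"
  assumes nq: "(\<lambda>n. ln (real n)) \<in> o(\<lambda>n. real n * q n)"
    and graph: "\<And>n u v. G n u v \<Longrightarrow> u < n \<and> v < n \<and> u \<noteq> v \<and> G n v u"
    and pr: "weakly_pseudorandom q G"
  shows "(\<lambda>n. p1LP (Z_times_edges (G n) n)) \<longlonglongrightarrow> 4 - 2 * sqrt 3"
proof (rule tendstoI)
  fix e :: real assume e: "0 < e"
  \<comment> \<open>The cap keeps \<open>p\<close> a probability, and it stays above
    \<open>p0\<close> because \<open>p0 < 1\<close>.\<close>
  define p where "p = min 1 (p0 + e / 2)"
  have p: "p0 < p" "p \<le> 1" "p < p0 + e" using e sqrt3_bounds by (auto simp: p_def)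
  have "\<forall>\<^sub>F n in sequentially. p \<in> percolating (Z_times_edges (G n) n)"
    using nq graph pr p(1,2) by (rule eventually_percolating)
  then show "\<forall>\<^sub>F n in sequentially. dist (p1LP (Z_times_edges (G n) n)) p0 < e"
    using eventually_gt_at_top[of 0]
  proof eventually_elim
    case (elim n)
    have G: "u \<noteq> v" if "G n u v" for u v using graph[OF that] by simp
    show ?case
      using p1LP_bounds[of p "G n" n] elim G p(3) by (auto simp: dist_real_def)
  qed
qed

end
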